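(* Let $\delta$ be a divisorial semidegree on $\mathbb{C}[x,y]$ (i.e. $-\delta$ is a divisorial discrete valuation centered at infinity on $\mathbb{C}[x,y]$) with $\delta(x)>0$, and let $g_0,\ldots,g_{n+1}$ be the key forms of $\delta$ in $(x,y)$-coordinates. Then: (1) $\delta$ is non-negative on $\mathbb{C}[x,y]$ if and only if $\delta(g_{n+1})$ is non-negative. (2) $\delta$ is positive on $\mathbb{C}[x,y]$ if and only if one of the following holds: (a) $\delta(g_{n+1})$ is positive; (b) $\delta(g_{n+1})=0$ and $g_k\notin\mathbb{C}[x,y]$ for some $k$, $0\le k\le n+1$. In (2), condition (b) may be replaced by (b$'$) $\delta(g_{n+1})=0$ and $g_{n+1}\notin\mathbb{C}[x,y]$. Moreover, conditions (b) and (b$'$) are equivalent.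
   Context: A discrete valuation on $\mathbb{C}(x,y)$ is a map $\nu:\mathbb{C}(x,y)\setminus\{0\}\to\mathbb{Z}$ with $\nu(f+g)\ge\min\{\nu(f),\nu(g)\}$ and $\nu(fg)=\nu(f)+\nu(g)$. Embed $\mathbb{C}^2$ (with polynomial coordinates $(x,y)$) into $\mathbb{P}^2$ by $(x,y)\mapsto[1:x:y]$. The valuation $\nu$ is *divisorial* if there are a normal algebraic surface $Y_\nu$, a birational map $\sigma:Y_\nu\to\mathbb{P}^2$ and an (irreducible) curve $C_\nu$ on $Y_\nu$ such that for all non-zero $f\in\mathbb{C}[x,y]$, $\nu(f)$ is the order of vanishing of $\sigma^*(f)$ along $C_\nu$. It is *centered at infinity* if $\sigma(C_\nu)\subseteq\mathbb{P}^2\setminus\mathbb{C}^2$; equivalently, $\nu(f)<0$ for some non-zero $f\in\mathbb{C}[x,y]$. A *divisorial semidegree* is a map $\delta:\mathbb{C}(x,y)\setminus\{0\}\to\mathbb{Z}$ such that $-\delta$ is a divisorial discrete valuation; a divisorial semidegree on $\mathbb{C}[x,y]$ is one for which $-\delta$ is in addition centered at infinity. "$\delta$ is non-negative on $\mathbb{C}[x,y]$" means $\delta(f)\ge 0$ for all $f\in\mathbb{C}[x,y]\setminus\{0\}$; "$\delta$ is positive on $\mathbb{C}[x,y]$" means $\delta(f)>0$ for all $f\in\mathbb{C}[x,y]\setminus\mathbb{C}$. *Key forms.* Let $\delta$ be a divisorial semidegree on $\mathbb{C}[x,y]$ with $\delta(x)>0$. A finite sequence $g_0,g_1,\ldots,g_{n+1}\in\mathbb{C}[x,x^{-1},y]$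 is the sequence of key forms of $\delta$ (in $(x,y)$-coordinates) if the following hold (there is a unique such sequence): (P0) $g_0=x$, $g_1=y$. (P1) Let $\omega_j:=\delta(g_j)$, $0\le j\le n+1$. Then $\omega_{j+1}<\alpha_j\omega_j=\sum_{i=0}^{j-1}\beta_{j,i}\omega_i$ for $1\le j\le n$, where $\alpha_j=\min\{\alpha\in\mathbb{Z}_{>0}:\alpha\omega_j\in\mathbb{Z}\omega_0+\cdots+\mathbb{Z}\omega_{j-1}\}$ for $1\le j\le n$, and the $\beta_{j,i}$ are integers with $0\le\beta_{j,i}<\alpha_i$ for $1\le i<j\le n$ (the $\beta_{j,0}$ are allowed to be negative). (P2) For $1\le j\le n$ there is $\theta_j\in\mathbb{C}^*$ such that $g_{j+1}=g_j^{\alpha_j}-\theta_j\,g_0^{\beta_{j,0}}\cdots g_{j-1}^{\beta_{j,j-1}}$. (P3) Let $y_1,\ldots,y_{n+1}$ be indeterminates and let $\omega$ be the weighted degree on $B:=\mathbb{C}[x,x^{-1},y_1,\ldots,y_{n+1}]$ with weight $\omega_0$ for $x$ and $\omega_j$ for $y_j$, $1\le j\le n+1$ (the value of $\omega$ on an element is the maximum weight of its monomials). Then for every non-zero $g\in\mathbb{C}[x,x^{-1},y]$, $\delta(g)=\min\{\omega(G):G\in B,\ G(x,g_1,\ldots,g_{n+1})=g\}$. *)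

theory Defs
  imports
    "HOL-Analysis.Analysis"
    "HOL-Computational_Algebra.Computational_Algebra"
    "HOL-Library.Poly_Mapping"
begin

section \<open>The field \<open>\<complex>(x,y)\<close> and its subrings\<close>

text \<open>\<open>\<complex>[x,y]\<close> is \<open>(\<complex>[x])[y]\<close>: the inner polynomial variable is \<open>x\<close>, the outer one is \<open>y\<close>.\<close>

type_synonym ratfun = "complex poly poly fract"

definition of_bipoly :: "complex poly poly \<Rightarrow> ratfun" where
  "of_bipoly p = Fraction_Field.Fract p 1"

definition cst :: "complex \<Rightarrow> ratfun" where
  "cst c = of_bipoly [:[:c:]:]"

definition X :: ratfun where
  "X = of_bipoly [:[:0, 1:]:]"

definition Y :: ratfun where
  "Y = of_bipoly [:0, 1:]"

definition Cxy :: "ratfun set" where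
  "Cxy = range of_bipoly"

definition Cxxinvy :: "ratfun set" where
  "Cxxinvy = {f / X ^ k | f k. f \<in> Cxy}"


section \<open>Normal surfaces birational to the plane\<close>

text \<open>
  A surface \<open>S\<close> with a birational map \<open>\<sigma>\<close> to the projective plane is described, after identifying
  its function field with \<open>\<complex>(x,y)\<close> by \<open>\<sigma>\<^sup>*\<close>, as a model in the sense of Zariski: the set of local
  rings \<open>O\<^bsub>S,P\<^esub>\<close>, as subrings of \<open>\<complex>(x,y)\<close>, of all points \<open>P\<close> of \<open>S\<close>, closed or not. Every integral
  separated scheme of finite type over \<open>\<complex>\<close> with function field \<open>\<complex>(x,y)\<close> is determined by, and may be
  identified with, such a set. Its dimension is 2, the transcendence degree of \<open>\<complex>(x,y)\<close>.
\<close>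

definition C_subalgebra :: "ratfun set \<Rightarrow> bool" where
  "C_subalgebra A \<longleftrightarrow> range cst \<subseteq> A \<and> (\<forall>a\<in>A. \<forall>b\<in>A. a + b \<in> A \<and> a * b \<in> A)"

definition affine_ring :: "ratfun set \<Rightarrow> bool" where
  "affine_ring A \<longleftrightarrow>
     (\<exists>S. finite S \<and> A = C_subalgebra hull S) \<and>
     {a / b | a b. a \<in> A \<and> b \<in> A \<and> b \<noteq> 0} = UNIV"

definition prime_ideal_of :: "ratfun set \<Rightarrow> ratfun set \<Rightarrow> bool" where
  "prime_ideal_of A p \<longleftrightarrow>
     p \<subseteq> A \<and> p \<noteq> A \<and> 0 \<in> p \<and>
     (\<forall>a\<in>p. \<forall>b\<in>p. a + b \<in> p) \<and> (\<forall>a\<in>A. \<forall>b\<in>p. a * b \<in> p) \<and>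
     (\<forall>a\<in>A. \<forall>b\<in>A. a * b \<in> p \<longrightarrow> a \<in> p \<or> b \<in> p)"

definition localization_at :: "ratfun set \<Rightarrow> ratfun set \<Rightarrow> ratfun set" where
  "localization_at A p = {a / s | a s. a \<in> A \<and> s \<in> A - p}"

definition nonunits :: "ratfun set \<Rightarrow> ratfun set" where
  "nonunits R = {a \<in> R. a = 0 \<or> inverse a \<notin> R}"

definition valuation_ring :: "ratfun set \<Rightarrow> bool" where
  "valuation_ring V \<longleftrightarrow> C_subalgebra V \<and> (\<forall>a. a \<in> V \<or> inverse a \<in> V)"

definition dominates :: "ratfun set \<Rightarrow> ratfun set \<Rightarrow> bool" where
  "dominates V R \<longleftrightarrow> R \<subseteq> V \<and> nonunits V \<inter> R = nonunits R"

text \<open>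
  The last condition below is the valuative form of separatedness: a valuation ring has at most one
  centre on the surface.
\<close>

definition algebraic_surface :: "ratfun set set \<Rightarrow> bool" where
  "algebraic_surface S \<longleftrightarrow>
     (\<exists>\<A>. finite \<A> \<and> \<A> \<noteq> {} \<and> (\<forall>A\<in>\<A>. affine_ring A) \<and>
        S = {localization_at A p | A p. A \<in> \<A> \<and> prime_ideal_of A p}) \<and>
     (\<forall>V. valuation_ring V \<longrightarrow>
        (\<forall>R\<in>S. \<forall>R'\<in>S. dominates V R \<and> dominates V R' \<longrightarrow> R = R'))"

definition integrally_closed :: "ratfun set \<Rightarrow> bool" where
  "integrally_closed R \<longleftrightarrow>
     (\<forall>a q. lead_coeff q = 1 \<and> (\<forall>i. coeff q i \<in> R) \<and> poly q a = 0 \<longrightarrow> a \<in> R)"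

definition normal_surface :: "ratfun set set \<Rightarrow> bool" where
  "normal_surface S \<longleftrightarrow> algebraic_surface S \<and> (\<forall>R\<in>S. integrally_closed R)"

text \<open>
  An irreducible curve \<open>C\<close> on \<open>S\<close> is given by its generic point, that is, by the local ring
  \<open>O\<^bsub>S,C\<^esub>\<close>. As \<open>S\<close> has dimension 2, the curves are the points whose local ring has Krull dimension 1.
\<close>

definition curve_on :: "ratfun set set \<Rightarrow> ratfun set \<Rightarrow> bool" where
  "curve_on S R \<longleftrightarrow>
     R \<in> S \<and> nonunits R \<noteq> {0} \<and> {p. prime_ideal_of R p} = {{0}, nonunits R}"

text \<open>For \<open>f \<noteq> 0\<close>: \<open>f\<close> is a unit of \<open>R\<close> times the \<open>k\<close>-th power of a uniformizer of \<open>R\<close>.\<close>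

definition vanishes_to_order :: "ratfun set \<Rightarrow> ratfun \<Rightarrow> int \<Rightarrow> bool" where
  "vanishes_to_order R f k \<longleftrightarrow>
     (\<exists>t u. nonunits R = {t * a | a. a \<in> R} \<and> u \<in> R - nonunits R \<and> f = u * t powi k)"


section \<open>Valuations and semidegrees\<close>

text \<open>Valuations and semidegrees are only meaningful on non-zero elements; the value at 0 is arbitrary.\<close>

definition discrete_valuation :: "(ratfun \<Rightarrow> int) \<Rightarrow> bool" where
  "discrete_valuation \<nu> \<longleftrightarrow>
     (\<forall>f g. f \<noteq> 0 \<and> g \<noteq> 0 \<longrightarrow>
        (f + g \<noteq> 0 \<longrightarrow> \<nu> (f + g) \<ge> min (\<nu> f) (\<nu> g)) \<and> \<nu> (f * g) = \<nu> f + \<nu> g)"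

definition divisorial_valuation :: "(ratfun \<Rightarrow> int) \<Rightarrow> bool" where
  "divisorial_valuation \<nu> \<longleftrightarrow>
     discrete_valuation \<nu> \<and>
     (\<exists>S C. normal_surface S \<and> curve_on S C \<and>
        (\<forall>f\<in>Cxy - {0}. vanishes_to_order C f (\<nu> f)))"

definition centered_at_infinity :: "(ratfun \<Rightarrow> int) \<Rightarrow> bool" where
  "centered_at_infinity \<nu> \<longleftrightarrow> (\<exists>f\<in>Cxy - {0}. \<nu> f < 0)"

definition divisorial_semidegree_on_Cxy :: "(ratfun \<Rightarrow> int) \<Rightarrow> bool" where
  "divisorial_semidegree_on_Cxy \<delta> \<longleftrightarrow>
     divisorial_valuation (\<lambda>f. - \<delta> f) \<and> centered_at_infinity (\<lambda>f. - \<delta> f)"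

definition nonneg_on_Cxy :: "(ratfun \<Rightarrow> int) \<Rightarrow> bool" where
  "nonneg_on_Cxy \<delta> \<longleftrightarrow> (\<forall>f\<in>Cxy - {0}. \<delta> f \<ge> 0)"

definition positive_on_Cxy :: "(ratfun \<Rightarrow> int) \<Rightarrow> bool" where
  "positive_on_Cxy \<delta> \<longleftrightarrow> (\<forall>f\<in>Cxy - range cst. \<delta> f > 0)"


section \<open>Key forms\<close>

text \<open>
  Elements of \<open>\<complex>[x,x\<^sup>-\<^sup>1,y\<^sub>1,\<dots>,y\<^sub>m]\<close>: the exponent \<open>(a, b)\<close> stands for the monomial
  \<open>x\<^sup>a y\<^sub>1\<^bsup>b 1\<^esup> \<cdots> y\<^sub>m\<^bsup>b m\<^esup>\<close>, where \<open>a\<close> may be negative.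
\<close>

type_synonym laurent = "(int \<times> (nat \<Rightarrow>\<^sub>0 nat)) \<Rightarrow>\<^sub>0 complex"

definition laurent_ring :: "nat \<Rightarrow> laurent set" where
  "laurent_ring m = {G. \<forall>e\<in>Poly_Mapping.keys G. Poly_Mapping.keys (snd e) \<subseteq> {1..m}}"

definition subst_laurent :: "nat \<Rightarrow> (nat \<Rightarrow> ratfun) \<Rightarrow> laurent \<Rightarrow> ratfun" where
  "subst_laurent m g G =
     (\<Sum>e\<in>Poly_Mapping.keys G. cst (Poly_Mapping.lookup G e) * X powi fst e *
        (\<Prod>j=1..m. g j ^ Poly_Mapping.lookup (snd e) j))"

text \<open>The weight of \<open>x\<close> is \<open>\<omega> 0\<close> and that of \<open>y\<^sub>j\<close> is \<open>\<omega> j\<close>; only used for \<open>G \<noteq> 0\<close>.\<close>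

definition weighted_degree :: "nat \<Rightarrow> (nat \<Rightarrow> int) \<Rightarrow> laurent \<Rightarrow> int" where
  "weighted_degree m \<omega> G =
     Max ((\<lambda>e. \<omega> 0 * fst e + (\<Sum>j=1..m. \<omega> j * int (Poly_Mapping.lookup (snd e) j)))
        ` Poly_Mapping.keys G)"

definition key_alpha :: "(nat \<Rightarrow> int) \<Rightarrow> nat \<Rightarrow> nat" where
  "key_alpha \<omega> j = (LEAST a. a > 0 \<and> (\<exists>c :: nat \<Rightarrow> int. int a * \<omega> j = (\<Sum>i<j. c i * \<omega> i)))"

text \<open>\<open>g 0, \<dots>, g (n + 1)\<close> are the key forms of \<open>\<delta>\<close>; the values \<open>g j\<close> with \<open>j > n + 1\<close> play no role.\<close>

definition key_forms :: "(ratfun \<Rightarrow> int) \<Rightarrow> nat \<Rightarrow> (nat \<Rightarrow> ratfun) \<Rightarrow> bool" where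
  "key_forms \<delta> n g \<longleftrightarrow>
     (let \<omega> = (\<lambda>j. \<delta> (g j)); \<alpha> = key_alpha \<omega> in
        (\<forall>j\<le>n + 1. g j \<in> Cxxinvy) \<and>
        g 0 = X \<and> g 1 = Y \<and>
        (\<exists>(\<beta> :: nat \<Rightarrow> nat \<Rightarrow> int) (\<theta> :: nat \<Rightarrow> complex).
           (\<forall>j\<in>{1..n}.
              \<omega> (j + 1) < int (\<alpha> j) * \<omega> j \<and>
              int (\<alpha> j) * \<omega> j = (\<Sum>i<j. \<beta> j i * \<omega> i) \<and>
              (\<forall>i. 1 \<le> i \<and> i < j \<longrightarrow> 0 \<le> \<beta> j i \<and> \<beta> j i < int (\<alpha> i))) \<and>
           (\<forall>j\<in>{1..n}.
              \<theta> j \<noteq> 0 \<and> g (j + 1) = g j ^ \<alpha> j - cst (\<theta> j) * (\<Prod>i<j. g i powi \<beta> j i))) \<and>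
        (\<forall>h\<in>Cxxinvy - {0}.
           (\<exists>G\<in>laurent_ring (n + 1).
              subst_laurent (n + 1) g G = h \<and> weighted_degree (n + 1) \<omega> G = \<delta> h) \<and>
           (\<forall>G\<in>laurent_ring (n + 1).
              subst_laurent (n + 1) g G = h \<longrightarrow> \<delta> h \<le> weighted_degree (n + 1) \<omega> G)))"

end

(*
  An element of C[x,1/x,y] of y-degree N expands in the monomials x^a g_1^{b_1} ... g_{n+1}^{b_{n+1}}
  with 0 <= b_j < alpha_j for j <= n. Apart from x^a such a monomial is monic in y, and each y-degree
  occurs exactly once; by (P3) and the relations between the g_j, the semidegree of an element is at
  least the weight of each monomial in its expansion.

  If delta(g_{n+1}) >= 0, then all omega_j with j <= n are positive, and the leading coefficient of a
  polynomial f in y, being a polynomial in x, yields a monomial of nonnegative weight.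
  If delta(g_{n+1}) < 0, a count of unknowns and equations gives a polynomial of negative semidegree.

  Let delta(g_{n+1}) = 0 and let f be a nonconstant polynomial with delta(f) = 0. Up to a constant,
  f = g_{n+1}^L + (lower terms of weight <= 0). Substituting the definition of g_{k+1} repeatedly
  gives, for every k <= n and some L > 0,
  f = (g_k^{alpha_k} - theta_k x^{beta_{k,0}} ...)^L + (terms of smaller weight).
  The second term of the binomial expansion is not cancelled; so if g_1, ..., g_k are polynomials,
  then beta_{k,0} >= 0, and g_{k+1} is a polynomial.
*)
theory Submission
  imports Defs
begin

section \<open>Coordinates with respect to a sequence of monic polynomials\<close>

text \<open>The minimum in (P3) runs over all expressions G, reduced or not. To bound the reduced
  coordinates one needs that rewriting a product of monomials into reduced form never raises the
  weight. This is the multiplicativity of the filtrations \<open>B k\<close>. It has to be proved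
  level by level, because replacing g_k^{\<alpha>_k} creates a product at level k that must be
  reduced again.

  A strict drop is recorded as well, in \<open>Z\<close>: when an element of level k is rewritten at
  level k+1, every term involving g_{k+1} has lost weight. This keeps the second binomial term
  alive: higher powers of the subtracted monomial cannot regain a factor g_k without falling below
  the top weight.

  Coefficients are taken in C((x)), where x is invertible and single coefficients can be read off.
  An upper bound on the weight leaves finitely many powers of x, so the filtrations stay inside
  C[x,1/x,y].

  The count in the negative case succeeds because the weights of the monomials of y-degree below D
  have a sum that tends to minus infinity quadratically in D.\<close>

definition monic_of_degree :: "'a::comm_ring_1 poly \<Rightarrow> nat \<Rightarrow> bool" where
  "monic_of_degree p k \<longleftrightarrow> degree p = k \<and> coeff p k = 1"

definition monic_seq :: "(nat \<Rightarrow> 'a::comm_ring_1 poly) \<Rightarrow> bool" where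
  "monic_seq E \<longleftrightarrow> (\<forall>i. monic_of_degree (E i) i)"

text \<open>Indexed by all naturals and zero beyond the degree, so that the linearity laws hold at
  every index without comparing degrees.\<close>

definition coords :: "(nat \<Rightarrow> 'a::comm_ring_1 poly) \<Rightarrow> 'a poly \<Rightarrow> nat \<Rightarrow> 'a" where
  "coords E q = (THE c. (\<forall>i>degree q. c i = 0) \<and> q = (\<Sum>i\<le>degree q. smult (c i) (E i)))"

lemma monic_of_degree_mult:
  fixes p q :: "'a::idom poly"
  assumes "monic_of_degree p k" "monic_of_degree q l"
  shows "monic_of_degree (p * q) (k + l)"
proof -
  have "p \<noteq> 0" "q \<noteq> 0" using assms by (auto simp: monic_of_degree_def)
  then show ?thesis
    using assms coeff_mult_degree_sum[of p q] by (auto simp: monic_of_degree_def degree_mult_eq)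
qed

lemma monic_of_degree_power:
  fixes p :: "'a::idom poly"
  assumes "monic_of_degree p k"
  shows "monic_of_degree (p ^ c) (c * k)"
proof (induction c)
  case 0
  show ?case by (simp add: monic_of_degree_def)
next
  case (Suc c)
  with monic_of_degree_mult[OF assms Suc] show ?case by simp
qed

lemma monic_of_degree_diff:
  assumes "monic_of_degree p k" "degree q < k"
  shows "monic_of_degree (p - q) k"
  using assms degree_add_eq_left[of "- q" p] by (auto simp: monic_of_degree_def coeff_eq_0)

lemma monic_seq_degree: "monic_seq E \<Longrightarrow> degree (E i) = i"
  by (simp add: monic_seq_def monic_of_degree_def)

lemma monic_seq_coeff: "monic_seq E \<Longrightarrow> coeff (E i) i = 1"
  by (simp add: monic_seq_def monic_of_degree_def)

lemma coeff_monic_combination: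
  assumes "monic_seq E"
  shows "coeff (\<Sum>i\<le>N. smult (c i) (E i)) N = c N"
proof -
  have "coeff (\<Sum>i\<le>N. smult (c i) (E i)) N = (\<Sum>i\<le>N. c i * coeff (E i) N)"
    by (simp add: coeff_sum)
  also have "\<dots> = (\<Sum>i\<le>N. if i = N then c N else 0)"
    by (rule sum.cong)
       (auto simp: monic_seq_coeff[OF assms] coeff_eq_0 monic_seq_degree[OF assms])
  finally show ?thesis by simp
qed

lemma monic_combination_eq_0:
  assumes "monic_seq E" "(\<Sum>i\<le>N. smult (c i) (E i)) = 0" "i \<le> N"
  shows "c i = 0"
  using assms(2,3)
proof (induction N)
  case 0
  then show ?case using coeff_monic_combination[OF assms(1), of c 0] by simp
next
  case (Suc N)
  have "c (Suc N) = 0"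
    using coeff_monic_combination[OF assms(1), of c "Suc N"] unfolding Suc.prems(1) by simp
  with Suc show ?case by (cases "i = Suc N") auto
qed

lemma monic_combination_exists:
  assumes E: "monic_seq E"
  shows "degree q \<le> N \<Longrightarrow> \<exists>c. (\<forall>i>N. c i = 0) \<and> q = (\<Sum>i\<le>N. smult (c i) (E i))"
proof (induction N arbitrary: q)
  case 0
  have "E 0 = 1"
    using monic_seq_degree[OF E, of 0] monic_seq_coeff[OF E, of 0] by (auto elim!: degree_eq_zeroE)
  moreover obtain a where "q = [:a:]" using 0 by (auto elim!: degree_eq_zeroE)
  ultimately show ?case by (intro exI[of _ "\<lambda>i. if i = 0 then a else 0"]) auto
next
  case (Suc N)
  define r where "r = q - smult (coeff q (Suc N)) (E (Suc N))"
  have "degree r \<le> N"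
  proof (rule degree_le, intro allI impI)
    fix i assume "i > N"
    then show "coeff r i = 0"
      using Suc.prems monic_seq_coeff[OF E, of i] monic_seq_degree[OF E, of "Suc N"]
      by (cases "i = Suc N") (auto simp: r_def coeff_eq_0)
  qed
  then obtain c where c: "\<forall>i>N. c i = 0" "r = (\<Sum>i\<le>N. smult (c i) (E i))"
    using Suc.IH by blast
  have "(\<Sum>i\<le>N. smult ((c(Suc N := coeff q (Suc N))) i) (E i)) = (\<Sum>i\<le>N. smult (c i) (E i))"
    by (rule sum.cong) auto
  then have "q = (\<Sum>i\<le>Suc N. smult ((c(Suc N := coeff q (Suc N))) i) (E i))"
    using c(2) by (simp add: r_def algebra_simps)
  then show ?case using c(1) by (intro exI[of _ "c(Suc N := coeff q (Suc N))"]) auto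
qed

text \<open>Expansions of different lengths are padded with zeros to a common length; comparing
  leading coefficients from the top downwards then shows that their difference is trivial.\<close>

lemma coords_eqI:
  assumes E: "monic_seq E" and q: "q = (\<Sum>i\<le>N. smult (c i) (E i))" and c: "\<And>i. i > N \<Longrightarrow> c i = 0"
  shows "coords E q = c"
proof -
  have uniq: "a = b"
    if "\<forall>i>M. a i = 0" "q = (\<Sum>i\<le>M. smult (a i) (E i))"
       "\<forall>i>K. b i = 0" "q = (\<Sum>i\<le>K. smult (b i) (E i))" for a b M K
  proof
    fix i
    have ext: "(\<Sum>i\<le>M. smult (d i) (E i)) = (\<Sum>i\<le>max i (max M K). smult (d i) (E i))"
      if "\<forall>i>M. d i = 0" "M \<le> max i (max M K)" for d i M K
      using that by (intro sum.mono_neutral_left) auto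
    let ?R = "max i (max M K)"
    have "q = (\<Sum>i\<le>?R. smult (a i) (E i))" using ext[OF that(1), of i K] that(2) by simp
    moreover have "q = (\<Sum>i\<le>?R. smult (b i) (E i))"
      using ext[OF that(3), of i M] that(4) by (simp add: max.commute max.left_commute)
    ultimately have "(\<Sum>i\<le>?R. smult (a i - b i) (E i)) = 0"
      by (simp add: smult_diff_left sum_subtractf)
    from monic_combination_eq_0[OF E this, of i] show "a i = b i" by simp
  qed
  obtain a where a: "\<forall>i>degree q. a i = 0" "q = (\<Sum>i\<le>degree q. smult (a i) (E i))"
    using monic_combination_exists[OF E order_refl] by blast
  have "coords E q = a"
    unfolding coords_def by (rule the_equality) (use a uniq in blast)+
  also have "a = c" using uniq a q c by blast
  finally show ?thesis .
qed

lemma coords_expand: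
  assumes E: "monic_seq E" and N: "degree q \<le> N"
  shows "q = (\<Sum>i\<le>N. smult (coords E q i) (E i))"
proof -
  obtain a where a: "\<forall>i>N. a i = 0" "q = (\<Sum>i\<le>N. smult (a i) (E i))"
    using monic_combination_exists[OF E N] by blast
  with coords_eqI[OF E a(2)] show ?thesis by metis
qed

lemma coords_eq_0:
  assumes E: "monic_seq E" and i: "i > degree q"
  shows "coords E q i = 0"
proof -
  obtain a where a: "\<forall>i>degree q. a i = 0" "q = (\<Sum>i\<le>degree q. smult (a i) (E i))"
    using monic_combination_exists[OF E order_refl] by blast
  with coords_eqI[OF E a(2)] i show ?thesis by metis
qed

lemma coords_degree: "monic_seq E \<Longrightarrow> coords E q (degree q) = lead_coeff q"
  using coeff_monic_combination[of E "coords E q" "degree q"] coords_expand[of E q "degree q"] by simp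

lemma coords_add:
  assumes E: "monic_seq E"
  shows "coords E (p + q) i = coords E p i + coords E q i"
proof -
  let ?N = "max (degree p) (degree q)"
  have "p + q = (\<Sum>i\<le>?N. smult (coords E p i + coords E q i) (E i))"
    using coords_expand[OF E, of p ?N] coords_expand[OF E, of q ?N]
    by (simp add: smult_add_left sum.distrib)
  from coords_eqI[OF E this] show ?thesis by (simp add: coords_eq_0[OF E])
qed

lemma coords_smult:
  assumes E: "monic_seq E"
  shows "coords E (smult a q) i = a * coords E q i"
proof -
  have "smult a q = (\<Sum>i\<le>degree q. smult (a * coords E q i) (E i))"
    using arg_cong[OF coords_expand[OF E, of q "degree q"], of "\<lambda>q. [:a:] * q"]
    by (simp add: sum_distrib_left mult.commute)
  from coords_eqI[OF E this] show ?thesis by (simp add: coords_eq_0[OF E])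
qed

lemma coords_0: "monic_seq E \<Longrightarrow> coords E 0 i = 0"
  using coords_smult[of E 0 0 i] by simp

lemma coords_minus: "monic_seq E \<Longrightarrow> coords E (- q) i = - coords E q i"
  using coords_smult[of E "-1" q i] by simp

lemma coords_diff: "monic_seq E \<Longrightarrow> coords E (p - q) i = coords E p i - coords E q i"
  using coords_add[of E p "- q" i] by (simp add: coords_minus)

lemma coords_sum: "monic_seq E \<Longrightarrow> coords E (sum f A) i = (\<Sum>s\<in>A. coords E (f s) i)"
  by (induction A rule: infinite_finite_induct) (auto simp: coords_0 coords_add)

lemma coords_basis: "monic_seq E \<Longrightarrow> coords E (E j) i = (if i = j then 1 else 0)"
proof -
  assume E: "monic_seq E"
  have "E j = (\<Sum>i\<le>j. if i = j then E j else 0)" by simp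
  also have "\<dots> = (\<Sum>i\<le>j. smult (if i = j then 1 else 0) (E i))" by (rule sum.cong) auto
  finally show ?thesis by (subst coords_eqI[OF E]) auto
qed

text \<open>Division by monic polynomials uses only differences and products of coefficients. The
  set \<open>S\<close> will be the ring of power series in x.\<close>

lemma coords_closed:
  assumes E: "monic_seq E"
    and S: "0 \<in> S" "\<And>a b. a \<in> S \<Longrightarrow> b \<in> S \<Longrightarrow> a - b \<in> S" "\<And>a b. a \<in> S \<Longrightarrow> b \<in> S \<Longrightarrow> a * b \<in> S"
    and ES: "\<And>i j. coeff (E i) j \<in> S" and qS: "\<And>j. coeff q j \<in> S"
  shows "coords E q i \<in> S"
proof -
  have "degree q \<le> N \<Longrightarrow> (\<And>j. coeff q j \<in> S) \<Longrightarrow> coords E q i \<in> S" for N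
  proof (induction N arbitrary: q)
    case 0
    then show ?case
      using S(1) coords_degree[OF E, of q] coords_eq_0[OF E, of q i] by (cases "i = 0") auto
  next
    case (Suc N)
    define r where "r = q - smult (coeff q (Suc N)) (E (Suc N))"
    have "degree r \<le> N"
    proof (rule degree_le, intro allI impI)
      fix i assume "i > N"
      then show "coeff r i = 0"
        using Suc.prems monic_seq_coeff[OF E, of i] monic_seq_degree[OF E, of "Suc N"]
        by (cases "i = Suc N") (auto simp: r_def coeff_eq_0)
    qed
    moreover have "coeff r j \<in> S" for j
      using S Suc.prems(2) ES by (auto simp: r_def)
    ultimately have IH: "coords E r i \<in> S" by (rule Suc.IH)
    have "coords E r i = coords E q i - coeff q (Suc N) * (if i = Suc N then 1 else 0)"
      by (simp add: r_def coords_diff[OF E] coords_smult[OF E] coords_basis[OF E])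
    show ?case
    proof (cases "i = Suc N")
      case True
      then have "coords E q i = coeff q (Suc N)"
        using Suc.prems(1) coords_degree[OF E, of q] coords_eq_0[OF E, of q i]
        by (cases "degree q = Suc N") (auto simp: coeff_eq_0)
      then show ?thesis using Suc.prems(2) by simp
    next
      case False
      with IH \<open>coords E r i = _\<close> show ?thesis by simp
    qed
  qed
  from this[OF order_refl qS] show ?thesis .
qed

section \<open>Key polynomials over Laurent series\<close>

text \<open>The relations of (P1) and (P2), read in C((x))[y]: \<open>e j\<close> is the exponent of
  x in the monomial subtracted to form g_{j+1}, possibly negative, and \<open>b j i\<close> is the
  exponent of g_i.\<close>

locale key_seq =
  fixes n :: nat and \<alpha> :: "nat \<Rightarrow> nat" and e :: "nat \<Rightarrow> int" and b :: "nat \<Rightarrow> nat \<Rightarrow> nat"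
    and \<theta> :: "nat \<Rightarrow> complex" and \<omega> :: "nat \<Rightarrow> int" and gp :: "nat \<Rightarrow> complex fls poly"
  assumes omega0: "\<omega> 0 > 0"
    and alpha_pos: "\<And>j. 1 \<le> j \<Longrightarrow> j \<le> n \<Longrightarrow> \<alpha> j > 0"
    and b_less: "\<And>i j. 1 \<le> i \<Longrightarrow> i < j \<Longrightarrow> j \<le> n \<Longrightarrow> b j i < \<alpha> i"
    and weight: "\<And>j. 1 \<le> j \<Longrightarrow> j \<le> n \<Longrightarrow>
      int (\<alpha> j) * \<omega> j = \<omega> 0 * e j + (\<Sum>i=1..<j. \<omega> i * int (b j i))"
    and omega_less: "\<And>j. 1 \<le> j \<Longrightarrow> j \<le> n \<Longrightarrow> \<omega> (Suc j) < int (\<alpha> j) * \<omega> j"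
    and theta_nz: "\<And>j. 1 \<le> j \<Longrightarrow> j \<le> n \<Longrightarrow> \<theta> j \<noteq> 0"
    and gp_1: "gp (Suc 0) = [:0, 1:]"
    and gp_Suc: "\<And>j. 1 \<le> j \<Longrightarrow> j \<le> n \<Longrightarrow>
      gp (Suc j) = gp j ^ \<alpha> j
        - smult (fls_const (\<theta> j) * fls_X_intpow (e j)) (\<Prod>i=1..<j. gp i ^ b j i)"
begin

text \<open>The y-degree of g_j, as \<open>gp_monic\<close> shows.\<close>

definition d :: "nat \<Rightarrow> nat" where "d j = (\<Prod>i=1..<j. \<alpha> i)"

text \<open>The y-degree of the monomial subtracted to form g_{j+1}; being below \<open>d j\<close>,
  it identifies that monomial as \<open>E (j - 1) (m j)\<close>.\<close>

definition m :: "nat \<Rightarrow> nat" where "m j = (\<Sum>i=1..<j. b j i * d i)"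

text \<open>
  \<open>E k i\<close> is the monomial of \<open>y\<close>-degree \<open>i\<close> in \<open>g\<^sub>1, \<dots>, g\<^sub>k\<close> in which \<open>g\<^sub>j\<close>, \<open>j < k\<close>, has exponent
  less than \<open>\<alpha>\<^sub>j\<close>, and \<open>w k i\<close> is its weight. Level 0 is artificial, with the variable \<open>y\<close> given
  a weight above \<open>\<omega> 1\<close>, so that the step from level 0 to level 1 is like the others.
\<close>

primrec E :: "nat \<Rightarrow> nat \<Rightarrow> complex fls poly" where
  "E 0 i = [:0, 1:] ^ i"
| "E (Suc k) i = E k (i mod d (Suc k)) * gp (Suc k) ^ (i div d (Suc k))"

primrec w :: "nat \<Rightarrow> nat \<Rightarrow> int" where
  "w 0 i = (\<omega> 1 + 1) * int i"
| "w (Suc k) i = w k (i mod d (Suc k)) + \<omega> (Suc k) * int (i div d (Suc k))"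

lemma d_simps [simp]: "d 0 = 1" "d (Suc 0) = 1"
  by (simp_all add: d_def)

lemma d_Suc: "k \<ge> 1 \<Longrightarrow> d (Suc k) = d k * \<alpha> k"
  by (simp add: d_def)

lemma d_pos: "k \<le> Suc n \<Longrightarrow> d k > 0"
  unfolding d_def by (intro prod_pos) (auto intro: alpha_pos)

lemma E_0 [simp]: "E k 0 = 1"
  by (induction k) auto

lemma w_0 [simp]: "w k 0 = 0"
  by (induction k) auto

lemma E_Suc_less: "i < d (Suc k) \<Longrightarrow> E (Suc k) i = E k i"
  by simp

lemma w_Suc_less: "i < d (Suc k) \<Longrightarrow> w (Suc k) i = w k i"
  by simp

lemma E_shift: "1 \<le> k \<Longrightarrow> k \<le> Suc n \<Longrightarrow> E k (i + c * d k) = E k i * gp k ^ c"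
  using d_pos[of k] by (cases k) (auto simp: power_add)

lemma w_shift: "1 \<le> k \<Longrightarrow> k \<le> Suc n \<Longrightarrow> w k (i + c * d k) = w k i + \<omega> k * int c"
  using d_pos[of k] by (cases k) (auto simp: algebra_simps)

text \<open>Exponents below \<alpha>_i are the digits of a mixed radix expansion with place values
  \<open>d i\<close>, so the y-degree determines the monomial.\<close>

lemma prod_gp:
  assumes "\<And>i. 1 \<le> i \<Longrightarrow> i \<le> k \<Longrightarrow> c i < \<alpha> i" "k \<le> n"
  shows "(\<Prod>i=1..k. gp i ^ c i) = E k (\<Sum>i=1..k. c i * d i) \<and>
    (\<Sum>i=1..k. c i * d i) < d (Suc k) \<and>
    w k (\<Sum>i=1..k. c i * d i) = (\<Sum>i=1..k. \<omega> i * int (c i))"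
  using assms
proof (induction k)
  case 0
  then show ?case by simp
next
  case (Suc k)
  let ?s = "\<Sum>i=1..k. c i * d i"
  have IH: "(\<Prod>i=1..k. gp i ^ c i) = E k ?s" "?s < d (Suc k)"
      "w k ?s = (\<Sum>i=1..k. \<omega> i * int (c i))"
    using Suc by auto
  have "c (Suc k) + 1 \<le> \<alpha> (Suc k)" using Suc.prems(1)[of "Suc k"] by simp
  from mult_le_mono1[OF this, of "d (Suc k)"]
  have "?s + c (Suc k) * d (Suc k) < d (Suc (Suc k))"
    using IH(2) d_Suc[of "Suc k"] by (simp add: mult.commute)
  then show ?case using IH by simp
qed

lemma m_props:
  assumes "1 \<le> j" "j \<le> n"
  shows "(\<Prod>i=1..<j. gp i ^ b j i) = E (j - 1) (m j)" "m j < d j"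
    "\<omega> 0 * e j + w (j - 1) (m j) = int (\<alpha> j) * \<omega> j"
proof -
  obtain k where k: "j = Suc k" using assms by (cases j) auto
  have "{1..<j} = {1..k}" using k by auto
  moreover have "b j i < \<alpha> i" if "1 \<le> i" "i \<le> k" for i using b_less[of i j] that assms k by auto
  ultimately show "(\<Prod>i=1..<j. gp i ^ b j i) = E (j - 1) (m j)" "m j < d j"
    "\<omega> 0 * e j + w (j - 1) (m j) = int (\<alpha> j) * \<omega> j"
    using prod_gp[of k "b j"] assms k weight[of j] by (auto simp: m_def)
qed

lemma gp_rec:
  assumes "1 \<le> j" "j \<le> n"
  shows "gp (Suc j) = gp j ^ \<alpha> j - smult (fls_const (\<theta> j) * fls_X_intpow (e j)) (E (j - 1) (m j))"
  using gp_Suc[OF assms] m_props(1)[OF assms] by simp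

lemma monic_E_aux:
  assumes "\<And>j. 1 \<le> j \<Longrightarrow> j \<le> k \<Longrightarrow> monic_of_degree (gp j) (d j)"
  shows "monic_of_degree (E k i) i"
  using assms
proof (induction k arbitrary: i)
  case 0
  have "monic_of_degree [:0, 1 :: complex fls:] 1" by (simp add: monic_of_degree_def)
  from monic_of_degree_power[OF this, of i] show ?case by simp
next
  case (Suc k)
  have "monic_of_degree (E k (i mod d (Suc k)) * gp (Suc k) ^ (i div d (Suc k)))
      (i mod d (Suc k) + i div d (Suc k) * d (Suc k))"
    by (intro monic_of_degree_mult monic_of_degree_power Suc) auto
  then show ?case unfolding E.simps mod_div_mult_eq .
qed

lemma gp_monic: "1 \<le> j \<Longrightarrow> j \<le> Suc n \<Longrightarrow> monic_of_degree (gp j) (d j)"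
proof (induction j rule: less_induct)
  case (less j)
  show ?case
  proof (cases "j = Suc 0")
    case True
    then show ?thesis by (simp add: gp_1 monic_of_degree_def)
  next
    case False
    then obtain k where k: "j = Suc k" "1 \<le> k" "k \<le> n" using less.prems by (cases j) auto
    have p: "monic_of_degree (gp k ^ \<alpha> k) (d j)"
      using monic_of_degree_power[OF less.IH[of k], of "\<alpha> k"] k d_Suc[of k]
      by (simp add: mult.commute)
    let ?q = "smult (fls_const (\<theta> k) * fls_X_intpow (e k)) (E (k - 1) (m k))"
    have "monic_of_degree (E (k - 1) (m k)) (m k)"
      by (rule monic_E_aux) (use less.IH k in auto)
    then have "degree ?q \<le> m k"
      using degree_smult_le[of _ "E (k - 1) (m k)"] by (metis monic_of_degree_def)
    also have "m k < d k" using m_props(2) k by auto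
    also have "d k \<le> d j" using k d_Suc[of k] alpha_pos[of k] by auto
    finally show ?thesis using gp_rec[of k] k monic_of_degree_diff[OF p] by simp
  qed
qed

lemma monic_E: "k \<le> Suc n \<Longrightarrow> monic_seq (E k)"
  using monic_E_aux[of k] gp_monic by (auto simp: monic_seq_def)

subsection \<open>The filtration by weighted degree\<close>

text \<open>Since \<open>\<omega> 0\<close> is positive, such a bound leaves a Laurent series with
  finitely many terms.\<close>

definition bnd :: "complex fls \<Rightarrow> int \<Rightarrow> bool" where
  "bnd c v \<longleftrightarrow> (\<forall>a. fls_nth c a \<noteq> 0 \<longrightarrow> \<omega> 0 * a \<le> v)"

lemma bnd_0 [simp]: "bnd 0 v" by (simp add: bnd_def)

lemma bnd_mono: "bnd c v \<Longrightarrow> v \<le> v' \<Longrightarrow> bnd c v'"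
  unfolding bnd_def by (meson order_trans)

lemma bnd_add: "bnd c v \<Longrightarrow> bnd c' v \<Longrightarrow> bnd (c + c') v"
  unfolding bnd_def fls_plus_nth by (metis add.right_neutral)

lemma bnd_diff: "bnd c v \<Longrightarrow> bnd c' v \<Longrightarrow> bnd (c - c') v"
  unfolding bnd_def fls_minus_nth by (metis diff_zero)

lemma bnd_sum: "(\<And>s. s \<in> A \<Longrightarrow> bnd (f s) v) \<Longrightarrow> bnd (sum f A) v"
  by (induction A rule: infinite_finite_induct) (auto intro: bnd_add)

lemma bnd_mult: assumes "bnd c v" "bnd c' v'" shows "bnd (c * c') (v + v')"
  unfolding bnd_def
proof (intro allI impI)
  fix a assume "fls_nth (c * c') a \<noteq> 0"
  then obtain i where "fls_nth c i * fls_nth c' (a - i) \<noteq> 0"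
    unfolding fls_times_nth(2) by (meson sum.neutral)
  then have "\<omega> 0 * i \<le> v" "\<omega> 0 * (a - i) \<le> v'" using assms by (auto simp: bnd_def)
  then show "\<omega> 0 * a \<le> v + v'" by (simp add: algebra_simps)
qed

lemma bnd_X: "bnd (fls_X_intpow a) (\<omega> 0 * a)"
  by (auto simp: bnd_def)

lemma bnd_const: "bnd (fls_const c) 0"
  by (auto simp: bnd_def)

lemma bnd_const_X: "bnd (fls_const c * fls_X_intpow a) (\<omega> 0 * a)"
  using bnd_mult[OF bnd_const bnd_X] by simp

lemma bnd_1: "bnd 1 0"
  using bnd_X[of 0] by simp

text \<open>For k = n + 1 this turns out to be the set where the semidegree is at most v, see
  \<open>in_B\<close> and \<open>delta_le_B\<close>.\<close>

definition B :: "nat \<Rightarrow> int \<Rightarrow> complex fls poly set" where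
  "B k v = {q. \<forall>i. bnd (coords (E k) q i) (v - w k i)}"

text \<open>\<open>Z k v\<close> consists of the elements of \<open>B k v\<close> whose part of weight \<open>v\<close> does not involve \<open>g\<^sub>k\<close>.\<close>

definition Z :: "nat \<Rightarrow> int \<Rightarrow> complex fls poly set" where
  "Z k v = {q. \<forall>i. bnd (coords (E k) q i) (v - w k i - (if d k \<le> i then 1 else 0))}"

lemma Z_subset_B: "Z k v \<subseteq> B k v"
proof
  fix q assume q: "q \<in> Z k v"
  have "bnd (coords (E k) q i) (v - w k i)" for i
    using q bnd_mono[of _ "v - w k i - (if d k \<le> i then 1 else 0)" "v - w k i"]
    by (auto simp: Z_def)
  then show "q \<in> B k v" by (simp add: B_def)
qed

lemma B_less_subset_Z: "v' < v \<Longrightarrow> B k v' \<subseteq> Z k v"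
  unfolding Z_def B_def
  by (clarify, rule bnd_mono[where v = "v' - w k i" for i]) auto

lemma B_mono: "v \<le> v' \<Longrightarrow> B k v \<subseteq> B k v'"
  unfolding B_def by (clarify, rule bnd_mono[where v = "v - w k i" for i]) auto

context
  fixes k assumes k: "k \<le> Suc n"
begin

lemma B_sum: "(\<And>s. s \<in> A \<Longrightarrow> f s \<in> B k v) \<Longrightarrow> sum f A \<in> B k v"
  by (auto simp: B_def coords_sum[OF monic_E[OF k]] intro: bnd_sum)

lemma Z_sum: "(\<And>s. s \<in> A \<Longrightarrow> f s \<in> Z k v) \<Longrightarrow> sum f A \<in> Z k v"
  by (simp add: Z_def coords_sum[OF monic_E[OF k]] bnd_sum)

lemma B_add: "p \<in> B k v \<Longrightarrow> q \<in> B k v \<Longrightarrow> p + q \<in> B k v"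
  by (simp add: B_def coords_add[OF monic_E[OF k]] bnd_add)

lemma Z_add: "p \<in> Z k v \<Longrightarrow> q \<in> Z k v \<Longrightarrow> p + q \<in> Z k v"
  by (simp add: Z_def coords_add[OF monic_E[OF k]] bnd_add)

lemma B_smult: "bnd c v' \<Longrightarrow> q \<in> B k v \<Longrightarrow> smult c q \<in> B k (v + v')"
  using bnd_mult[of c v' "coords (E k) q i" "v - w k i" for i]
  by (simp add: B_def coords_smult[OF monic_E[OF k]] algebra_simps)

lemma Z_smult:
  assumes "bnd c v'" "q \<in> Z k v" shows "smult c q \<in> Z k (v + v')"
  unfolding Z_def
proof (clarify)
  fix i
  have "bnd (coords (E k) q i) (v - w k i - (if d k \<le> i then 1 else 0))"
    using assms(2) by (simp add: Z_def)
  from bnd_mult[OF assms(1) this]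
  show "bnd (coords (E k) (smult c q) i) (v + v' - w k i - (if d k \<le> i then 1 else 0))"
    by (simp add: coords_smult[OF monic_E[OF k]] algebra_simps)
qed

lemma B_E: "E k i \<in> B k (w k i)"
  by (auto simp: B_def coords_basis[OF monic_E[OF k]] bnd_1)

lemma Z_E: "i < d k \<Longrightarrow> E k i \<in> Z k (w k i)"
  by (auto simp: Z_def coords_basis[OF monic_E[OF k]] bnd_1)

lemma B_term: "bnd c (v - w k i) \<Longrightarrow> smult c (E k i) \<in> B k v"
  using B_smult[OF _ B_E, of c "v - w k i" i] by simp

lemma B_diff: "p \<in> B k v \<Longrightarrow> q \<in> B k v \<Longrightarrow> p - q \<in> B k v"
  by (simp add: B_def coords_diff[OF monic_E[OF k]] bnd_diff)

lemma B_expand: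
  assumes "q \<in> B k v"
  shows "q = (\<Sum>i\<le>degree q. smult (coords (E k) q i) (E k i))" "bnd (coords (E k) q i) (v - w k i)"
  using assms coords_expand[OF monic_E[OF k]] by (auto simp: B_def)

end

section \<open>Multiplicativity of the filtrations and comparison of consecutive levels\<close>

lemma coords_mult_gp_power:
  assumes "1 \<le> k" "k \<le> Suc n"
  shows "coords (E k) (q * gp k ^ c) (i + c * d k) = coords (E k) q i"
proof -
  note M = monic_E[OF assms(2)]
  have "q * gp k ^ c = (\<Sum>j\<le>degree q. smult (coords (E k) q j) (E k j)) * gp k ^ c"
    using coords_expand[OF M, of q] by simp
  also have "\<dots> = (\<Sum>j\<le>degree q. smult (coords (E k) q j) (E k (j + c * d k)))"
    by (simp add: sum_distrib_right E_shift[OF assms])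
  finally have "coords (E k) (q * gp k ^ c) (i + c * d k) =
      coords (E k) (\<Sum>j\<le>degree q. smult (coords (E k) q j) (E k (j + c * d k))) (i + c * d k)"
    by (rule arg_cong)
  also have "\<dots> = (\<Sum>j\<le>degree q. if j = i then coords (E k) q i else 0)"
    unfolding coords_sum[OF M]
    by (rule sum.cong) (auto simp: coords_smult[OF M] coords_basis[OF M])
  also have "\<dots> = coords (E k) q i"
    by (auto simp: coords_eq_0[OF M])
  finally show ?thesis .
qed

lemma B_mult_gp_power:
  assumes k: "1 \<le> k" "k \<le> Suc n" and q: "q \<in> B k v"
  shows "q * gp k ^ c \<in> B k (v + \<omega> k * int c)"
proof -
  have "q * gp k ^ c = (\<Sum>j\<le>degree q. smult (coords (E k) q j) (E k j)) * gp k ^ c"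
    using B_expand(1)[OF k(2) q] by simp
  also have "\<dots> = (\<Sum>j\<le>degree q. smult (coords (E k) q j) (E k (j + c * d k)))"
    by (simp add: sum_distrib_right E_shift[OF k])
  also have "\<dots> \<in> B k (v + \<omega> k * int c)"
    using B_expand(2)[OF k(2) q] by (intro B_sum[OF k(2)] B_term[OF k(2)]) (simp add: w_shift[OF k])
  finally show ?thesis .
qed

text \<open>A separate predicate because of the interlocking induction: multiplicativity at level k
  is used to pass from level k to level k+1, and this passage yields multiplicativity at level
  k+1.\<close>

definition B_mult_closed :: "nat \<Rightarrow> bool" where
  "B_mult_closed k \<longleftrightarrow> (\<forall>v v'. \<forall>q\<in>B k v. \<forall>r\<in>B k v'. q * r \<in> B k (v + v'))"

lemma B_mult_closedI:
  assumes k: "k \<le> Suc n" and E: "\<And>i j. E k i * E k j \<in> B k (w k i + w k j)"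
  shows "B_mult_closed k"
  unfolding B_mult_closed_def
proof (intro allI ballI)
  fix v v' q r assume q: "q \<in> B k v" and r: "r \<in> B k v'"
  let ?c = "coords (E k) q" and ?c' = "coords (E k) r"
  have "q * r = (\<Sum>i\<le>degree q. smult (?c i) (E k i)) * (\<Sum>j\<le>degree r. smult (?c' j) (E k j))"
    using B_expand(1)[OF k q] B_expand(1)[OF k r] by simp
  also have "\<dots> = (\<Sum>i\<le>degree q. \<Sum>j\<le>degree r. smult (?c i * ?c' j) (E k i * E k j))"
    by (simp add: sum_product mult.commute)
  also have "\<dots> \<in> B k (v + v')"
  proof (intro B_sum[OF k])
    fix i j
    from B_smult[OF k bnd_mult[OF B_expand(2)[OF k q, of i] B_expand(2)[OF k r, of j]] E[of i j]]
    show "smult (?c i * ?c' j) (E k i * E k j) \<in> B k (v + v')" by simp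
  qed
  finally show "q * r \<in> B k (v + v')" .
qed

lemma gp_power_alpha:
  assumes k: "1 \<le> k" "k \<le> n"
  shows "gp k ^ \<alpha> k = gp (Suc k) + smult (fls_const (\<theta> k) * fls_X_intpow (e k)) (E k (m k))"
    "\<omega> 0 * e k + w k (m k) = int (\<alpha> k) * \<omega> k"
proof -
  have "E k (m k) = E (k - 1) (m k)" "w k (m k) = w (k - 1) (m k)"
    using E_Suc_less[of "m k" "k - 1"] w_Suc_less[of "m k" "k - 1"] m_props(2)[OF k] k by auto
  then show "gp k ^ \<alpha> k = gp (Suc k) + smult (fls_const (\<theta> k) * fls_X_intpow (e k)) (E k (m k))"
    "\<omega> 0 * e k + w k (m k) = int (\<alpha> k) * \<omega> k"
    using gp_rec[OF k] m_props(3)[OF k] by auto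
qed

text \<open>If \<open>s\<close> is at least \<open>d (Suc k)\<close>, a factor g_k^{\<alpha>_k}
  splits off and is replaced by g_{k+1} plus a monomial. The part with g_{k+1} loses weight by
  \<open>omega_less\<close>. The other part keeps its weight bound but has smaller degree; it is
  expanded again at level k, and induction on \<open>s\<close> applies. For k = 0 the artificial
  weight of y makes every positive power of y lose weight.\<close>

lemma E_in_Z:
  assumes k: "k \<le> n" and mult: "B_mult_closed k"
  shows "E k s \<in> Z (Suc k) (w k s)"
proof (cases "k = 0")
  case True
  show ?thesis
  proof (cases "s = 0")
    case True
    then show ?thesis using Z_E[of "Suc k" 0] d_pos[of "Suc k"] k by simp
  next
    case False
    have "E k s = E (Suc 0) s" using \<open>k = 0\<close> by (simp add: gp_1)
    moreover have "w (Suc 0) s < w k s" using \<open>k = 0\<close> False by (simp add: algebra_simps)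
    ultimately show ?thesis
      using B_E[of "Suc 0" s] B_less_subset_Z[of _ "w k s" "Suc 0"] \<open>k = 0\<close> by auto
  qed
next
  case False
  then have k1: "1 \<le> k" "k \<le> Suc n" and k2: "1 \<le> Suc k" "Suc k \<le> Suc n" using k by auto
  let ?D = "d (Suc k)"
  show ?thesis
  proof (induction s rule: less_induct)
    case (less s)
    show ?case
    proof (cases "s < ?D")
      case True
      then show ?thesis using Z_E[OF k2(2), of s] by simp
    next
      case s: False
      define s' where "s' = s - ?D"
      have D: "?D > 0" "?D = \<alpha> k * d k" using d_pos[OF k2(2)] d_Suc[OF k1(1)] by auto
      have s': "s = s' + \<alpha> k * d k" "s' < s" 
      proof -
        have "s > 0" using s D(1) by linarith
        then have "s' < s" using D(1) unfolding s'_def by (rule diff_less[rotated])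
        then show "s = s' + \<alpha> k * d k" "s' < s" using s D(2) by (auto simp: s'_def)
      qed
      let ?c = "fls_const (\<theta> k) * fls_X_intpow (e k)"
      have Es: "E k s = E k s' * gp (Suc k) + smult ?c (E k s' * E k (m k))"
        unfolding s'(1) E_shift[OF k1] gp_power_alpha(1)[OF k1(1) k] by (simp add: algebra_simps)
      have ws: "w k s = w k s' + int (\<alpha> k) * \<omega> k"
        unfolding s'(1) w_shift[OF k1] by simp
      have "E k s' \<in> B (Suc k) (w k s')" using less.IH[OF s'(2)] Z_subset_B by blast
      from B_mult_gp_power[OF k2 this, of 1]
      have "E k s' * gp (Suc k) \<in> B (Suc k) (w k s' + \<omega> (Suc k))" by simp
      then have 1: "E k s' * gp (Suc k) \<in> Z (Suc k) (w k s)"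
        using B_less_subset_Z[of "w k s' + \<omega> (Suc k)" "w k s" "Suc k"] omega_less[OF k1(1) k]
        by (auto simp: ws)
      let ?q = "E k s' * E k (m k)"
      have q: "?q \<in> B k (w k s' + w k (m k))"
        using mult B_E[OF k1(2)] by (auto simp: B_mult_closed_def)
      have "degree ?q = s' + m k"
        using monic_of_degree_mult[of "E k s'" s' "E k (m k)" "m k"] monic_E[OF k1(2)]
        by (auto simp: monic_seq_def monic_of_degree_def)
      also have "\<dots> < s" 
      proof -
        have "d k \<le> \<alpha> k * d k" using alpha_pos[OF k1(1) k] by simp
        then show ?thesis using m_props(2)[OF k1(1) k] s'(1) by linarith
      qed
      finally have dq: "degree ?q < s" .
      have "?q \<in> Z (Suc k) (w k s' + w k (m k))"
      proof (subst B_expand(1)[OF k1(2) q], rule Z_sum[OF k2(2)])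
        fix i assume "i \<in> {..degree ?q}"
        then have "E k i \<in> Z (Suc k) (w k i)" using less.IH[of i] dq by simp
        from Z_smult[OF k2(2) B_expand(2)[OF k1(2) q] this, of i]
        show "smult (coords (E k) ?q i) (E k i) \<in> Z (Suc k) (w k s' + w k (m k))" by simp
      qed
      moreover have "w k s' + w k (m k) + \<omega> 0 * e k = w k s"
        using gp_power_alpha(2)[OF k1(1) k] ws by linarith
      ultimately have "smult ?c ?q \<in> Z (Suc k) (w k s)"
        using Z_smult[OF k2(2) bnd_const_X, of ?q "w k s' + w k (m k)" "\<theta> k" "e k"] by (simp del: w.simps)
      with 1 show ?thesis unfolding Es by (rule Z_add[OF k2(2)])
    qed
  qed
qed

lemma B_subset_Z_aux:
  assumes k: "k \<le> n" and mult: "B_mult_closed k"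
  shows "B k v \<subseteq> Z (Suc k) v"
proof
  fix q assume q: "q \<in> B k v"
  have k': "k \<le> Suc n" "Suc k \<le> Suc n" using k by auto
  show "q \<in> Z (Suc k) v"
  proof (subst B_expand(1)[OF k'(1) q], rule Z_sum[OF k'(2)])
    fix i
    from Z_smult[OF k'(2) B_expand(2)[OF k'(1) q, of i] E_in_Z[OF k mult, of i]]
    show "smult (coords (E k) q i) (E k i) \<in> Z (Suc k) v" by simp
  qed
qed

text \<open>Two basis elements of level k+1 are low-degree elements of level k times powers of
  g_{k+1}. The low-degree parts multiply at level k, their product moves up without gaining weight,
  and the powers of g_{k+1} merely add.\<close>

lemma B_mult_closed: "k \<le> Suc n \<Longrightarrow> B_mult_closed k"
proof (induction k)
  case 0
  show ?case
  proof (rule B_mult_closedI)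
    fix i j
    have "E 0 i * E 0 j = E 0 (i + j)" "w 0 i + w 0 j = w 0 (i + j)"
      by (simp_all add: power_add algebra_simps)
    then show "E 0 i * E 0 j \<in> B 0 (w 0 i + w 0 j)" using B_E[of 0 "i + j"] by simp
  qed simp
next
  case (Suc k)
  then have k: "k \<le> n" "k \<le> Suc n" "1 \<le> Suc k" and mult: "B_mult_closed k" by auto
  show ?case
  proof (rule B_mult_closedI[OF Suc.prems])
    fix i j
    let ?D = "d (Suc k)"
    let ?q = "E k (i mod ?D) * E k (j mod ?D)"
    have "?q \<in> B k (w k (i mod ?D) + w k (j mod ?D))"
      using mult B_E[OF k(2)] by (auto simp: B_mult_closed_def)
    then have "?q \<in> B (Suc k) (w k (i mod ?D) + w k (j mod ?D))"
      using B_subset_Z_aux[OF k(1) mult] Z_subset_B by blast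
    from B_mult_gp_power[OF k(3) Suc.prems this, of "i div ?D + j div ?D"]
    show "E (Suc k) i * E (Suc k) j \<in> B (Suc k) (w (Suc k) i + w (Suc k) j)"
      by (simp add: power_add algebra_simps)
  qed
qed

lemma B_mult: "k \<le> Suc n \<Longrightarrow> q \<in> B k v \<Longrightarrow> r \<in> B k v' \<Longrightarrow> q * r \<in> B k (v + v')"
  using B_mult_closed[of k] by (simp add: B_mult_closed_def)

lemma B_subset_Z: "k \<le> n \<Longrightarrow> B k v \<subseteq> Z (Suc k) v"
  using B_subset_Z_aux B_mult_closed by simp

lemma B_subset:
  assumes "k \<le> k'" "k' \<le> Suc n"
  shows "B k v \<subseteq> B k' v"
  using assms
proof (induction k' rule: dec_induct)
  case (step j)
  then show ?case using B_subset_Z[of j v] Z_subset_B[of "Suc j" v] by auto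
qed simp

lemma B_1: "k \<le> Suc n \<Longrightarrow> 1 \<in> B k 0"
  using B_E[of k 0] by simp

lemma B_power: "k \<le> Suc n \<Longrightarrow> q \<in> B k v \<Longrightarrow> q ^ c \<in> B k (int c * v)"
proof (induction c)
  case (Suc c)
  from B_mult[OF Suc.prems(1) Suc.prems(2) Suc.IH[OF Suc.prems]] show ?case
    by (simp add: algebra_simps)
qed (simp add: B_1)

lemma B_prod:
  assumes "k \<le> Suc n" "\<And>j. j \<in> A \<Longrightarrow> f j \<in> B k (u j)"
  shows "prod f A \<in> B k (sum u A)"
  using assms(2)
  by (induction A rule: infinite_finite_induct) (auto intro: B_1 B_mult assms(1))

lemma gp_in_B: "1 \<le> j \<Longrightarrow> j \<le> Suc n \<Longrightarrow> gp j \<in> B j (\<omega> j)"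
  using B_mult_gp_power[OF _ _ B_1, of j 1] by simp

lemma gp_Suc_in_B:
  assumes k: "1 \<le> k" "k \<le> n"
  shows "gp (Suc k) \<in> B k (int (\<alpha> k) * \<omega> k)"
proof -
  have k': "k \<le> Suc n" using k by simp
  have "gp k ^ \<alpha> k \<in> B k (int (\<alpha> k) * \<omega> k)" using B_power[OF k' gp_in_B[OF k(1) k']] .
  moreover have "smult (fls_const (\<theta> k) * fls_X_intpow (e k)) (E k (m k)) \<in> B k (int (\<alpha> k) * \<omega> k)"
    using gp_power_alpha(2)[OF k] by (intro B_term[OF k'] bnd_mono[OF bnd_const_X]) simp
  ultimately show ?thesis
    using B_diff[OF k'] gp_power_alpha(1)[OF k] by (metis add_diff_cancel_right')
qed

subsection \<open>Descent\<close>

text \<open>Rewriting a factor g_{k+1} at level k raises the weight bound by \<alpha>_k \<omega>_k -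
  \<omega>_{k+1}, which is at least 1. A term with fewer than L such factors therefore stays below
  the top weight, and the only term with L of them is g_{k+1}^L itself, as f is monic.\<close>

lemma diff_gp_power_in_B:
  assumes k: "1 \<le> k" "k \<le> n"
    and f: "monic_of_degree f (L * d (Suc k))" "f \<in> B (Suc k) (int L * \<omega> (Suc k))"
  shows "f - gp (Suc k) ^ L \<in> B k (int L * (int (\<alpha> k) * \<omega> k) - 1)"
proof -
  have k': "k \<le> Suc n" "Suc k \<le> Suc n" "1 \<le> Suc k" using k by auto
  note M = monic_E[OF k'(2)]
  let ?N = "L * d (Suc k)" and ?c = "coords (E (Suc k)) f"
  have D: "d (Suc k) > 0" by (rule d_pos) fact
  have deg: "degree f = ?N" using f(1) by (simp add: monic_of_degree_def)
  define S where "S = (\<Sum>i<?N. smult (?c i) (E (Suc k) i))"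
  have c1: "?c ?N = 1" using coords_degree[OF M, of f] f(1) by (simp add: monic_of_degree_def)
  have EN: "E (Suc k) ?N = gp (Suc k) ^ L" using E_shift[OF k'(3,2), of 0 L] by (simp del: E.simps)
  have "f = (\<Sum>i\<le>?N. smult (?c i) (E (Suc k) i))"
    using coords_expand[OF M, of f ?N] deg by simp
  also have "\<dots> = S + smult (?c ?N) (E (Suc k) ?N)"
    by (simp only: lessThan_Suc_atMost[symmetric] sum.lessThan_Suc S_def)
  also have "\<dots> = S + gp (Suc k) ^ L" unfolding c1 EN by simp
  finally have "f - gp (Suc k) ^ L = S" by (rule diff_eq_eq[THEN iffD2])
  also have "S \<in> B k (int L * (int (\<alpha> k) * \<omega> k) - 1)"
    unfolding S_def
  proof (rule B_sum[OF k'(1)])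
    fix i assume "i \<in> {..<?N}"
    define r c where "r = i mod d (Suc k)" and "c = i div d (Suc k)"
    have c: "c < L" using \<open>i \<in> _\<close> by (simp add: c_def less_mult_imp_div_less)
    let ?a = "int (\<alpha> k) * \<omega> k"
    have "bnd (?c i) ((int L - int c) * \<omega> (Suc k) - w k r)"
      using B_expand(2)[OF k'(2) f(2), of i] by (simp add: r_def c_def algebra_simps)
    moreover have "(int L - int c) * \<omega> (Suc k) \<le> (int L - int c) * (?a - 1)"
      using c omega_less[OF k] by (intro mult_left_mono) auto
    moreover have "(int L - int c) * (?a - 1) \<le> (int L - int c) * ?a - 1"
      using c by (simp add: algebra_simps)
    ultimately have "bnd (?c i) (((int L - int c) * ?a - 1) - w k r)"
      by (elim bnd_mono) linarith
    then have "smult (?c i) (E k r) \<in> B k ((int L - int c) * ?a - 1)" by (rule B_term[OF k'(1)])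
    from B_mult[OF k'(1) this B_power[OF k'(1) gp_Suc_in_B[OF k], of c]]
    show "smult (?c i) (E (Suc k) i) \<in> B k (int L * ?a - 1)"
      by (simp add: r_def c_def algebra_simps)
  qed
  finally show ?thesis .
qed

text \<open>At each step down, g_{j+1} may be counted as g_j^{\<alpha>_j}, in degree and in weight
  bound; this multiplies L by \<alpha>_j.\<close>

lemma descent:
  assumes f: "monic_of_degree f (L * d (Suc n))" "f \<in> B (Suc n) (int L * \<omega> (Suc n))" "L > 0"
    and k: "1 \<le> k" "k \<le> Suc n"
  shows "\<exists>L>0. monic_of_degree f (L * d k) \<and> f \<in> B k (int L * \<omega> k)"
  using k(2,1)
proof (induction k rule: inc_induct)
  case base
  then show ?case using f by auto
next
  case (step j)
  then obtain L where L: "L > 0" "monic_of_degree f (L * d (Suc j))"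
    "f \<in> B (Suc j) (int L * \<omega> (Suc j))" by auto
  have j: "1 \<le> j" "j \<le> n" "j \<le> Suc n" using step by auto
  let ?v = "int L * (int (\<alpha> j) * \<omega> j)"
  have "f - gp (Suc j) ^ L \<in> B j ?v"
    using diff_gp_power_in_B[OF j(1,2) L(2,3)] B_mono[of "?v - 1" ?v j] by auto
  moreover have "gp (Suc j) ^ L \<in> B j ?v" using B_power[OF j(3) gp_Suc_in_B[OF j(1,2)]] .
  ultimately have "f \<in> B j ?v" using B_add[OF j(3)] by fastforce
  then show ?case using L j alpha_pos[OF j(1,2)] d_Suc[OF j(1)]
    by (intro exI[of _ "L * \<alpha> j"]) (auto simp: algebra_simps)
qed

end

section \<open>Coefficients without negative powers\<close>

definition nonneg_powers :: "complex fls set" where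
  "nonneg_powers = {c. \<forall>a<0. fls_nth c a = 0}"

definition regular :: "complex fls poly \<Rightarrow> bool" where
  "regular q \<longleftrightarrow> (\<forall>i. coeff q i \<in> nonneg_powers)"

lemma nonneg_powers_diff: "c \<in> nonneg_powers \<Longrightarrow> c' \<in> nonneg_powers \<Longrightarrow> c - c' \<in> nonneg_powers"
  by (simp add: nonneg_powers_def)

lemma nonneg_powers_mult:
  assumes "c \<in> nonneg_powers" "c' \<in> nonneg_powers"
  shows "c * c' \<in> nonneg_powers"
proof -
  have "fls_nth (c * c') a = 0" if "a < 0" for a
  proof -
    have "fls_nth c i * fls_nth c' (a - i) = 0" for i
      using assms that by (cases "i < 0") (auto simp: nonneg_powers_def)
    then show ?thesis unfolding fls_times_nth(2) by (intro sum.neutral) blast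
  qed
  then show ?thesis by (simp add: nonneg_powers_def)
qed

lemma nonneg_powers_sum: "(\<And>s. s \<in> A \<Longrightarrow> f s \<in> nonneg_powers) \<Longrightarrow> sum f A \<in> nonneg_powers"
  by (simp add: nonneg_powers_def fls_nth_sum)

lemma regular_mult: "regular p \<Longrightarrow> regular q \<Longrightarrow> regular (p * q)"
  unfolding regular_def coeff_mult by (blast intro: nonneg_powers_sum nonneg_powers_mult)

lemma regular_diff: "regular p \<Longrightarrow> regular q \<Longrightarrow> regular (p - q)"
  by (simp add: regular_def nonneg_powers_diff)

lemma regular_1: "regular 1"
  by (auto simp: regular_def nonneg_powers_def coeff_1)

lemma regular_power: "regular p \<Longrightarrow> regular (p ^ c)"
  by (induction c) (auto intro: regular_mult regular_1)

lemma regular_Y: "regular [:0, 1:]"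
  by (auto simp: regular_def nonneg_powers_def coeff_pCons split: nat.splits)

lemma regular_smult: "c \<in> nonneg_powers \<Longrightarrow> regular p \<Longrightarrow> regular (smult c p)"
  by (simp add: regular_def nonneg_powers_mult)

context key_seq begin

lemma regular_E: "(\<And>j. 1 \<le> j \<Longrightarrow> j \<le> k \<Longrightarrow> regular (gp j)) \<Longrightarrow> regular (E k i)"
proof (induction k arbitrary: i)
  case 0
  show ?case by (simp add: regular_power regular_Y)
next
  case (Suc k)
  have "regular (E k j)" for j by (rule Suc.IH) (use Suc.prems in auto)
  then show ?case using Suc.prems by (simp add: regular_mult regular_power)
qed

lemma coords_regular:
  assumes "k \<le> Suc n" "\<And>j. 1 \<le> j \<Longrightarrow> j \<le> k \<Longrightarrow> regular (gp j)" "regular f"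
  shows "coords (E k) f i \<in> nonneg_powers"
proof (rule coords_closed[OF monic_E[OF assms(1)]])
  show "0 \<in> nonneg_powers" by (simp add: nonneg_powers_def)
  show "coeff (E k i) j \<in> nonneg_powers" for i j
    using regular_E[of k i] assms(2) by (simp add: regular_def)
  show "coeff f j \<in> nonneg_powers" for j using assms(3) by (simp add: regular_def)
qed (auto intro: nonneg_powers_diff nonneg_powers_mult)

subsection \<open>The second term of the binomial expansion\<close>

lemma nth_coords_less:
  assumes "q \<in> B k v" "v < w k i + \<omega> 0 * a"
  shows "fls_nth (coords (E k) q i) a = 0"
  using assms by (force simp: B_def bnd_def)

text \<open>The index belongs to the basis element \<open>E k (m k)\<close> times g_k^{\<alpha>_k
  (L-1)}. The term l = 0 is a different basis element and l = 1 is a multiple of this one. For l >=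
  2 the top weight part of t^l is free of g_k, so in top weight the power of g_k is only \<alpha>_k
  (L-l).\<close>

lemma nth_coords_binomial_term:
  assumes k: "1 \<le> k" "k \<le> n" and l: "l \<le> L" and L: "L > 0"
  defines "t \<equiv> smult (fls_const (\<theta> k) * fls_X_intpow (e k)) (E k (m k))"
  defines "q \<equiv> of_nat (L choose l) * (- t) ^ l * (gp k ^ \<alpha> k) ^ (L - l)"
  shows "fls_nth (coords (E k) q (m k + (\<alpha> k * (L - 1)) * d k)) (e k) =
    (if l = 1 then - (of_nat L * \<theta> k) else 0)"
proof -
  have k': "k \<le> Suc n" "k - 1 \<le> n" "k - 1 \<le> Suc n" using k by auto
  note M = monic_E[OF k'(1)]
  have al: "\<alpha> k > 0" and dk: "d k > 0" and mk: "m k < d k"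
    using alpha_pos[OF k] d_pos[OF k'(1)] m_props(2)[OF k] by auto
  have L1: "L = (L - 1) + 1" using L by simp
  consider "l = 0" | "l = 1" | "l \<ge> 2" by linarith
  then show ?thesis
  proof cases
    case 1
    have "q = E k (0 + \<alpha> k * L * d k)"
      using 1 E_shift[OF k(1) k'(1), of 0 "\<alpha> k * L"] by (simp add: q_def power_mult)
    moreover have "m k + (\<alpha> k * (L - 1)) * d k < \<alpha> k * L * d k"
    proof -
      have "m k + (\<alpha> k * (L - 1)) * d k < d k + (\<alpha> k * (L - 1)) * d k" using mk by simp
      also have "\<dots> \<le> \<alpha> k * d k + (\<alpha> k * (L - 1)) * d k" using al by simp
      also have "\<dots> = \<alpha> k * L * d k" by (subst (2) L1) (simp add: algebra_simps)
      finally show ?thesis .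
    qed
    ultimately show ?thesis using 1 by (simp add: coords_basis[OF M])
  next
    case 2
    have "q = smult (- of_nat L * (fls_const (\<theta> k) * fls_X_intpow (e k)))
        (E k (m k + (\<alpha> k * (L - 1)) * d k))"
      using 2 E_shift[OF k(1) k'(1), of "m k" "\<alpha> k * (L - 1)"]
      by (simp add: q_def t_def power_mult of_nat_poly mult.commute)
    then show ?thesis using 2 
      by (simp add: coords_basis[OF M] coords_smult[OF M] coords_minus[OF M])
  next
    case 3
    let ?a = "int (\<alpha> k) * \<omega> k"
    define s where "s = of_nat (L choose l) * (- t) ^ l"
    have "E k (m k) = E (k - 1) (m k)" using E_Suc_less[of "m k" "k - 1"] mk k by auto
    then have "t \<in> B (k - 1) ?a"
      using B_term[OF k'(3), of _ ?a "m k"] m_props(3)[OF k] bnd_mono[OF bnd_const_X]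
      unfolding t_def by (metis add_diff_cancel_right' order_refl)
    from B_power[OF k'(3) this, of l] have "t ^ l \<in> B (k - 1) (int l * ?a)" .
    moreover have "(- t) ^ l = smult (fls_const ((-1) ^ l)) (t ^ l)" by (induction l) auto
    then have "s = smult (fls_const (of_nat (L choose l) * (-1) ^ l)) (t ^ l)"
      by (simp add: s_def of_nat_poly fls_of_nat mult.commute flip: fls_const_mult_const)
    ultimately have "s \<in> B (k - 1) (int l * ?a)"
      using B_smult[OF k'(3) bnd_const] by fastforce
    then have "s \<in> Z k (int l * ?a)" using B_subset_Z[OF k'(2)] k by auto
    \<comment> \<open>The index that remains after cancelling g_k^{\<alpha>_k (L-l)}. As l >= 2, it
      is at least \<open>d k\<close>, which is where membership in \<open>Z\<close> gives the strict
      bound.\<close>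
    define j where "j = m k + (\<alpha> k * (l - 1)) * d k"
    have "d k \<le> j"
    proof -
      have "1 \<le> \<alpha> k * (l - 1)" using al 3 by (simp add: Suc_le_eq)
      from mult_le_mono1[OF this, of "d k"] show ?thesis
        unfolding j_def mult_1 by (rule trans_le_add2)
    qed
    moreover have "bnd (coords (E k) s j) (int l * ?a - w k j - (if d k \<le> j then 1 else 0))"
      using \<open>s \<in> Z k _\<close> unfolding Z_def by blast
    ultimately have "bnd (coords (E k) s j) (int l * ?a - w k j - 1)" by simp
    moreover have "w k j = int l * ?a - \<omega> 0 * e k"
    proof -
      have "int (l - 1) = int l - 1" using 3 by simp
      then show ?thesis
        using gp_power_alpha(2)[OF k] unfolding j_def w_shift[OF k(1) k'(1)] by (simp add: algebra_simps)
    qed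
    ultimately have "fls_nth (coords (E k) s j) (e k) = 0" by (force simp: bnd_def)
    moreover have "q = s * gp k ^ (\<alpha> k * (L - l))" by (simp add: q_def s_def power_mult)
    moreover have "m k + (\<alpha> k * (L - 1)) * d k = j + (\<alpha> k * (L - l)) * d k"
    proof -
      have "L - 1 = (l - 1) + (L - l)" using 3 l by simp
      then show ?thesis by (simp add: j_def algebra_simps)
    qed
    ultimately show ?thesis using 3 coords_mult_gp_power[OF k(1) k'(1)] by simp
  qed
qed

text \<open>The coefficient in question has exactly the top weight, whereas f and g_{k+1}^L differ
  by an element of smaller weight; hence f inherits the coefficient from the binomial
  expansion.\<close>

lemma nth_coords_second_term:
  assumes k: "1 \<le> k" "k \<le> n" and L: "L > 0"
    and f: "f - gp (Suc k) ^ L \<in> B k (int L * (int (\<alpha> k) * \<omega> k) - 1)"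
  shows "fls_nth (coords (E k) f (m k + (\<alpha> k * (L - 1)) * d k)) (e k) = - (of_nat L * \<theta> k)"
proof -
  have k': "k \<le> Suc n" using k by simp
  note M = monic_E[OF k']
  let ?i = "m k + (\<alpha> k * (L - 1)) * d k"
  define t where "t = smult (fls_const (\<theta> k) * fls_X_intpow (e k)) (E k (m k))"
  have "gp (Suc k) = - t + gp k ^ \<alpha> k" using gp_power_alpha(1)[OF k] by (simp add: t_def)
  then have *: "gp (Suc k) ^ L = (\<Sum>l\<le>L. of_nat (L choose l) * (- t) ^ l * (gp k ^ \<alpha> k) ^ (L - l))"
    by (simp only: binomial_ring)
  have "fls_nth (coords (E k) (gp (Suc k) ^ L) ?i) (e k) =
      (\<Sum>l\<le>L. if l = 1 then - (of_nat L * \<theta> k) else 0)"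
    unfolding * coords_sum[OF M] fls_nth_sum
    by (intro sum.cong refl) (simp only: t_def atMost_iff nth_coords_binomial_term[OF k _ L])
  also have "\<dots> = - (of_nat L * \<theta> k)" using L by simp
  finally have 1: "fls_nth (coords (E k) (gp (Suc k) ^ L) ?i) (e k) = - (of_nat L * \<theta> k)" .
  have "w k ?i = w k (m k) + \<omega> k * int (\<alpha> k * (L - 1))" by (rule w_shift[OF k(1) k'])
  also have "\<dots> = int L * (int (\<alpha> k) * \<omega> k) - \<omega> 0 * e k"
    using gp_power_alpha(2)[OF k] L by (simp add: algebra_simps of_nat_diff)
  finally have "fls_nth (coords (E k) (f - gp (Suc k) ^ L) ?i) (e k) = 0"
    by (intro nth_coords_less[OF f]) simp
  with 1 show ?thesis by (simp add: coords_diff[OF M] eq_neg_iff_add_eq_0)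
qed

text \<open>If the earlier exponents are non-negative, then g_1, ..., g_k have coefficients in
  C[[x]], and so have the coordinates of f at level k. One of these coordinates contains x^{e_k}
  with a nonzero coefficient.\<close>

lemma e_nonneg:
  assumes f: "monic_of_degree f (L * d (Suc n))" "f \<in> B (Suc n) (int L * \<omega> (Suc n))" "L > 0"
    and reg: "regular f" and k: "1 \<le> k" "k \<le> n"
  shows "e k \<ge> 0"
  using k
proof (induction k rule: less_induct)
  case (less k)
  have "regular (gp j)" if "1 \<le> j" "j \<le> k" for j
    using that
  proof (induction j rule: less_induct)
    case (less j)
    note IH = less.IH
    show ?case
    proof (cases "j = Suc 0")
      case True
      then show ?thesis by (simp add: gp_1 regular_Y)
    next
      case False
      then obtain l where l: "j = Suc l" "1 \<le> l" "l \<le> n" "l < k"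
        using \<open>1 \<le> j\<close> \<open>j \<le> k\<close> \<open>k \<le> n\<close> by (cases j) auto
      have "regular (gp i)" if "1 \<le> i" "i \<le> l" for i using IH that l by auto
      then have "regular (gp l)" "regular (E (l - 1) (m l))" using l by (auto intro: regular_E)
      moreover have "fls_const (\<theta> l) * fls_X_intpow (e l) \<in> nonneg_powers"
        using \<open>\<And>y. y < k \<Longrightarrow> 1 \<le> y \<Longrightarrow> y \<le> n \<Longrightarrow> 0 \<le> e y\<close>[of l] l
        by (auto simp: nonneg_powers_def)
      ultimately show ?thesis
        using gp_rec[OF l(2,3)] l(1) by (simp add: regular_diff regular_power regular_smult)
    qed
  qed
  then have cr: "coords (E k) f i \<in> nonneg_powers" for i
    using less.prems reg by (intro coords_regular) auto
  \<comment> \<open>This L belongs to level k+1 and shadows the one of level n+1.\<close>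
  obtain L where L: "L > 0" "monic_of_degree f (L * d (Suc k))" "f \<in> B (Suc k) (int L * \<omega> (Suc k))"
    using descent[OF f, of "Suc k"] less.prems by auto
  have "fls_nth (coords (E k) f (m k + (\<alpha> k * (L - 1)) * d k)) (e k) \<noteq> 0"
    using nth_coords_second_term[OF less.prems L(1) diff_gp_power_in_B[OF less.prems L(2,3)]]
      theta_nz[OF less.prems] L(1) by simp
  with cr show ?case by (force simp: nonneg_powers_def)
qed

subsection \<open>Signs of the weights\<close>

lemma bnd_lead_coeff:
  assumes "k \<le> Suc n" "f \<in> B k v"
  shows "bnd (lead_coeff f) (v - w k (degree f))"
  using B_expand(2)[OF assms, of "degree f"] coords_degree[OF monic_E[OF assms(1)], of f] by simp

lemma omega_pos:
  assumes "\<omega> (Suc n) \<ge> 0" "1 \<le> j" "j \<le> n"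
  shows "\<omega> j > 0"
proof -
  have pos: "\<omega> i > 0" if "\<omega> (Suc i) \<ge> 0" "1 \<le> i" "i \<le> n" for i
    using omega_less[of i] that by (auto simp: zero_less_mult_iff dest: order.strict_trans1)
  have "j \<le> n \<Longrightarrow> 1 \<le> j \<Longrightarrow> \<omega> j > 0"
  proof (induction j rule: inc_induct)
    case base
    then show ?case using assms(1) pos by simp
  next
    case (step i)
    then show ?case using pos[of i] by simp
  qed
  then show ?thesis using assms by simp
qed

text \<open>The hypothesis on \<open>\<omega> 1\<close> serves level 0, where y has weight
  \<open>\<omega> 1 + 1\<close>. Non-negativity suffices there, which covers n = 0 with vanishing
  \<open>\<omega> 1\<close>.\<close>

lemma w_pos_aux:
  assumes "\<omega> 1 \<ge> 0" "\<And>j. 1 \<le> j \<Longrightarrow> j \<le> k \<Longrightarrow> \<omega> j > 0" "i > 0"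
  shows "w k i > 0"
  using assms
proof (induction k arbitrary: i)
  case (Suc k)
  show ?case
  proof (cases "i mod d (Suc k) = 0")
    case True
    then have "i div d (Suc k) > 0"
      using Suc.prems(3) by (metis div_mult_mod_eq gr0I mult_zero_left add.right_neutral less_irrefl)
    then show ?thesis using True Suc.prems(2)[of "Suc k"] by simp
  next
    case False
    then have "w k (i mod d (Suc k)) > 0" using Suc by simp
    moreover have "\<omega> (Suc k) * int (i div d (Suc k)) \<ge> 0" using Suc.prems(2)[of "Suc k"] by simp
    ultimately show ?thesis by simp
  qed
qed simp

text \<open>If \<omega>_{n+1} = 0, only the powers of g_{n+1} can have weight zero; their degrees
  are the multiples of \<open>d (Suc n)\<close>.\<close>

lemma w_Suc_n_pos:
  assumes "\<omega> (Suc n) \<ge> 0" "i > 0" "\<omega> (Suc n) > 0 \<or> \<not> d (Suc n) dvd i"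
  shows "w (Suc n) i > 0"
proof -
  have om: "\<omega> j > 0" if "1 \<le> j" "j \<le> n" for j using omega_pos assms that by simp
  then have om1: "\<omega> 1 \<ge> 0" using assms(1) by (cases "n = 0") (auto simp: less_imp_le)
  show ?thesis
  proof (cases "\<omega> (Suc n) > 0")
    case True
    then show ?thesis using om om1 assms(2) by (intro w_pos_aux) (auto simp: le_Suc_eq)
  next
    case False
    then have "i mod d (Suc n) > 0" using assms(3) by (auto simp: dvd_eq_mod_eq_0)
    then have "w n (i mod d (Suc n)) > 0" using om om1 by (intro w_pos_aux) auto
    then show ?thesis using assms(1) by (simp add: add_pos_nonneg)
  qed
qed

lemma w_Suc_n_nonneg: "\<omega> (Suc n) \<ge> 0 \<Longrightarrow> w (Suc n) i \<ge> 0"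
proof (cases "i > 0 \<and> (\<omega> (Suc n) > 0 \<or> \<not> d (Suc n) dvd i)")
  case False
  assume "\<omega> (Suc n) \<ge> 0"
  with False have "i mod d (Suc n) = 0" by auto
  with \<open>\<omega> (Suc n) \<ge> 0\<close> show ?thesis by simp
qed (use w_Suc_n_pos in \<open>simp add: less_imp_le\<close>)

end

section \<open>Polynomials of negative weight\<close>

text \<open>Gaussian elimination: the unknown \<open>p\<close> is a pivot of equation
  \<open>j\<close>, and its value \<open>c\<close> is recovered from the remaining unknowns.\<close>

lemma underdetermined_system:
  fixes A :: "'i \<Rightarrow> 'j \<Rightarrow> 'a::field"
  assumes "finite J" "finite I" "card J < card I"
  shows "\<exists>u. (\<exists>i\<in>I. u i \<noteq> 0) \<and> (\<forall>j\<in>J. (\<Sum>i\<in>I. u i * A i j) = 0)"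
  using assms
proof (induction J arbitrary: I A rule: finite_induct)
  case empty
  then show ?case by (intro exI[of _ "\<lambda>_. 1"]) (auto simp: card_gt_0_iff)
next
  case (insert j J)
  show ?case
  proof (cases "\<forall>i\<in>I. A i j = 0")
    case True
    have "card J < card I" using insert by simp
    from insert.IH[OF insert.prems(1) this] show ?thesis using True by auto
  next
    case False
    then obtain p where p: "p \<in> I" "A p j \<noteq> 0" by blast
    let ?I = "I - {p}"
    have "card J < card ?I" using insert p by simp
    from insert.IH[OF _ this, of "\<lambda>i j'. A i j' - A i j / A p j * A p j'"] insert.prems
    obtain u where u: "\<exists>i\<in>?I. u i \<noteq> 0"
      "\<And>j'. j' \<in> J \<Longrightarrow> (\<Sum>i\<in>?I. u i * (A i j' - A i j / A p j * A p j')) = 0" by auto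
    define c where "c = - (\<Sum>i\<in>?I. u i * A i j) / A p j"
    define u' where "u' = u(p := c)"
    have split: "(\<Sum>i\<in>I. u' i * A i j') = c * A p j' + (\<Sum>i\<in>?I. u i * A i j')" for j'
      using p insert.prems by (subst sum.remove[of I p]) (auto simp: u'_def intro!: sum.cong)
    have "(\<Sum>i\<in>I. u' i * A i j) = 0" using p by (simp add: split c_def)
    moreover have "(\<Sum>i\<in>I. u' i * A i j') = 0" if "j' \<in> J" for j'
    proof -
      have "c * A p j' = - (\<Sum>i\<in>?I. u i * (A i j / A p j * A p j'))"
        by (simp add: c_def sum_distrib_right sum_divide_distrib mult.assoc)
      then show ?thesis using u(2)[OF that] by (simp add: split right_diff_distrib sum_subtractf)
    qed
    moreover have "\<exists>i\<in>I. u' i \<noteq> 0" using u(1) by (auto simp: u'_def)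
    ultimately show ?thesis by blast
  qed
qed

section \<open>The embedding of C[x,y] into C((x))[y]\<close>

definition emb :: "complex poly poly \<Rightarrow> complex fls poly" where
  "emb = map_poly (\<lambda>c. fps_to_fls (fps_of_poly c))"

lemma coeff_emb: "coeff (emb p) i = fps_to_fls (fps_of_poly (coeff p i))"
  by (simp add: emb_def coeff_map_poly)

lemma emb_add: "emb (p + q) = emb p + emb q"
  by (rule poly_eqI) (simp add: coeff_emb fps_of_poly_add)

lemma emb_0: "emb 0 = 0"
  by (simp add: emb_def)

lemma emb_sum: "emb (sum f A) = (\<Sum>s\<in>A. emb (f s))"
  by (induction A rule: infinite_finite_induct) (auto simp: emb_0 emb_add)

lemma fps_to_fls_sum: "fps_to_fls (sum f A) = (\<Sum>s\<in>A. fps_to_fls (f s))"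
  by (induction A rule: infinite_finite_induct) auto

lemma emb_mult: "emb (p * q) = emb p * emb q"
  by (rule poly_eqI)
     (simp add: coeff_emb coeff_mult fps_of_poly_sum fps_of_poly_mult fps_to_fls_sum
       fls_times_fps_to_fls)

lemma emb_inj: "emb p = emb q \<Longrightarrow> p = q"
  by (rule poly_eqI) (metis coeff_emb fps_to_fls_eq_iff fps_of_poly_eq_iff)

lemma degree_emb: "degree (emb p) = degree p"
  unfolding emb_def by (rule degree_map_poly) (simp flip: fps_of_poly_0 add: fps_of_poly_eq_iff)

lemma regular_emb: "regular (emb p)"
  by (simp add: regular_def nonneg_powers_def coeff_emb)

lemma emb_monom: "emb (monom (monom u k) i) = smult (fls_const u * fls_X_intpow (int k)) ([:0, 1:] ^ i)"
proof -
  have "fps_to_fls (fps_of_poly (monom u k)) = fls_const u * fls_X_intpow (int k)"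
    by (rule fls_eqI) (auto simp: coeff_monom)
  then show ?thesis
    by (intro poly_eqI) (simp add: monom_altdef[symmetric] coeff_emb coeff_monom)
qed

lemma fls_nth_monomial_mult:
  fixes c :: "'a::comm_ring_1 fls"
  shows "fls_nth (fls_const u * fls_X_intpow k * c) a = u * fls_nth c (a - k)"
  unfolding mult.assoc fls_mult_const_nth fls_X_intpow_times_conv_shift(1) by simp

context key_seq begin

text \<open>The weights in the t-th block of \<open>d (Suc n)\<close> consecutive indices sum to a
  linear function of t with negative slope.\<close>

lemma sum_w_Suc_n_neg:
  assumes neg: "\<omega> (Suc n) < 0"
  shows "\<exists>D. (\<Sum>i<D. w (Suc n) i) < 0"
proof -
  let ?d = "d (Suc n)"
  have d: "?d > 0" by (rule d_pos) simp
  define S where "S = (\<Sum>r<?d. w n r)"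
  have block: "(\<Sum>i<T * ?d. w (Suc n) i) = (\<Sum>t<T. S + int ?d * \<omega> (Suc n) * int t)" for T
  proof -
    have "(\<Sum>i<T * ?d. w (Suc n) i) = (\<Sum>t<T. \<Sum>i\<in>{t * ?d..<t * ?d + ?d}. w (Suc n) i)"
      by (rule sum.nat_group[symmetric])
    also have "\<dots> = (\<Sum>t<T. \<Sum>r<?d. w (Suc n) (r + t * ?d))"
    proof (rule sum.cong)
      fix t
      have "(\<Sum>i\<in>{t * ?d..<t * ?d + ?d}. w (Suc n) i) = (\<Sum>i\<in>{0 + t * ?d..<?d + t * ?d}. w (Suc n) i)"
        by (simp add: add.commute)
      also have "\<dots> = (\<Sum>r<?d. w (Suc n) (r + t * ?d))"
        by (subst sum.shift_bounds_nat_ivl) (simp add: atLeast0LessThan)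
      finally show "(\<Sum>i\<in>{t * ?d..<t * ?d + ?d}. w (Suc n) i) = (\<Sum>r<?d. w (Suc n) (r + t * ?d))" .
    qed simp
    also have "\<dots> = (\<Sum>t<T. S + int ?d * \<omega> (Suc n) * int t)"
      using d by (intro sum.cong refl) (simp add: S_def sum.distrib algebra_simps)
    finally show ?thesis .
  qed
  have le: "(\<Sum>i<T * ?d. w (Suc n) i) \<le> (\<Sum>t<T. S - int t)" for T
  proof -
    have "int ?d * \<omega> (Suc n) \<le> 1 * (-1)"
      using d neg mult_mono[of 1 "int ?d" 1 "- \<omega> (Suc n)"] by simp
    then have *: "int ?d * \<omega> (Suc n) * int t \<le> (-1) * int t" for t by (intro mult_right_mono) auto
    have "S + int ?d * \<omega> (Suc n) * int t \<le> S - int t" for t using *[of t] by linarith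
    then show ?thesis unfolding block by (intro sum_mono)
  qed
  \<comment> \<open>Chosen so that the second factor 2 S - T + 1 of the closed form below is
    negative.\<close>
  define T where "T = Suc (2 * nat \<bar>S\<bar> + 1)"
  have "2 * (\<Sum>t<T. S - int t) = int T * (2 * S - int T + 1)" for T
    by (induction T) (auto simp: algebra_simps)
  moreover have "int T * (2 * S - int T + 1) < 0"
    by (rule mult_pos_neg) (auto simp: T_def)
  ultimately have "(\<Sum>t<T. S - int t) < 0" by (metis mult_less_0_iff not_numeral_less_zero)
  then show ?thesis using le[of T] by (intro exI[of _ "T * ?d"]) simp
qed

text \<open>
  Lattices over \<open>\<complex>[x]\<close> and over \<open>\<complex>[x\<^sup>-\<^sup>1]\<close> of the same rank \<open>D\<close>, namely the polynomials and the
  elements of negative weight of \<open>y\<close>-degree less than \<open>D\<close>, form a vector bundle on the projective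
  line, and by Riemann-Roch it has a nonzero section if its degree is large enough. As the change of
  basis between \<open>1, y, y\<^sup>2, \<dots>\<close> and \<open>E K\<close> is unitriangular, the degree can be read off the weights, and
  counting unknowns and equations suffices; the unknown polynomial is allowed \<open>x\<close>-degree up to \<open>R i\<close>
  in the coefficient of \<open>y\<^sup>i\<close>, where \<open>R\<close> decreases fast enough for the coordinates of the
  polynomial to obey the same bounds.
\<close>

lemma negative_weight_polynomial:
  assumes neg: "\<omega> (Suc n) < 0"
  shows "\<exists>p. p \<noteq> 0 \<and> emb p \<in> B (Suc n) (-1)"
proof -
  obtain D where D: "(\<Sum>i<D. w (Suc n) i) < 0" using sum_w_Suc_n_neg[OF neg] by blast
  define K where "K = Suc n"
  have K: "K \<le> Suc n" "1 \<le> K" by (auto simp: K_def)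
  note M = monic_E[OF K(1)]
  let ?y = "[:0, 1:] :: complex fls poly"
  define c where "c i j = coords (E K) (?y ^ i) j" for i j
  have y: "monic_of_degree (?y ^ i) i" for i
    using monic_of_degree_power[of ?y 1 i] by (simp add: monic_of_degree_def)
  have c0: "c i j = 0" if "i < j" for i j
    unfolding c_def using that y[of i] by (intro coords_eq_0[OF M]) (simp add: monic_of_degree_def)
  have c1: "c i i = 1" for i
    using coords_degree[OF M, of "?y ^ i"] y[of i] by (simp add: c_def monic_of_degree_def)
  have "?y \<in> B K (\<omega> 1)" using gp_in_B[of 1] B_subset[of 1 K] K by (auto simp: gp_1)
  from B_power[OF K(1) this] have yB: "bnd (c i j) (int i * \<omega> 1 - w K j)" for i j
    by (simp add: B_def c_def)
  \<comment> \<open>A common bound for the x-exponents in the change of basis. No division by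
    \<open>\<omega> 0\<close> is needed, as \<open>\<omega> 0\<close> is at least 1 and U is
    non-negative.\<close>
  define U where "U = (\<Sum>i<D. \<Sum>j<D. \<bar>int i * \<omega> 1 - w K j\<bar>)"
  have U0: "U \<ge> 0" by (auto simp: U_def intro!: sum_nonneg)
  have cU: "a \<le> U" if "i < D" "j < D" "fls_nth (c i j) a \<noteq> 0" for i j a
  proof -
    have "\<omega> 0 * a \<le> int i * \<omega> 1 - w K j" using yB[of i j] that(3) by (simp add: bnd_def)
    also have "\<dots> \<le> \<bar>int i * \<omega> 1 - w K j\<bar>" by simp
    also have "\<dots> \<le> (\<Sum>j<D. \<bar>int i * \<omega> 1 - w K j\<bar>)"
      using that by (intro member_le_sum) auto
    also have "\<dots> \<le> U" unfolding U_def
      using that by (intro member_le_sum[where f = "\<lambda>i. \<Sum>j<D. \<bar>int i * \<omega> 1 - w K j\<bar>"]) (auto intro: sum_nonneg)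
    finally have "\<omega> 0 * a \<le> U" .
    moreover have "a \<le> \<omega> 0 * a" if "a > 0" using omega0 that by simp
    ultimately show ?thesis using U0 by linarith
  qed
  \<comment> \<open>The largest exponent of x that coordinate i may contain if its weight is to be
    at most -1.\<close>
  define A where "A i = (- 1 - w K i) div \<omega> 0" for i
  have A: "a \<le> A i \<longleftrightarrow> \<omega> 0 * a \<le> - 1 - w K i" for a i
  proof -
    let ?x = "- 1 - w K i"
    have x: "\<omega> 0 * A i + ?x mod \<omega> 0 = ?x" "0 \<le> ?x mod \<omega> 0" "?x mod \<omega> 0 < \<omega> 0"
      using omega0 by (simp_all add: A_def)
    have "\<omega> 0 * a \<le> \<omega> 0 * A i" if "a \<le> A i" using that omega0 by simp
    moreover have "\<omega> 0 * (A i + 1) \<le> \<omega> 0 * a" if "\<not> a \<le> A i"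
      using that omega0 by (intro mult_left_mono) auto
    ultimately show ?thesis using x unfolding distrib_left mult_1_right by linarith
  qed
  define R where "R i = int D * U + (\<Sum>j<D. \<bar>A j\<bar>) - int i * U" for i
  have RA: "R i \<ge> 0" "R i \<ge> A i" if "i < D" for i
  proof -
    have "int i * U \<le> int D * U" using that U0 by (intro mult_right_mono) auto
    moreover have "\<bar>A i\<bar> \<le> (\<Sum>j<D. \<bar>A j\<bar>)" using that by (intro member_le_sum) auto
    ultimately show "R i \<ge> 0" "R i \<ge> A i" by (auto simp: R_def)
  qed
  \<comment> \<open>\<open>I\<close> indexes the unknown coefficients, and \<open>J\<close> the
    coefficients of the coordinates whose weight is too large. Exponents above \<open>R j\<close>
    vanish automatically, so \<open>J\<close> stops there.\<close>
  define I where "I = (SIGMA i:{..<D}. {0..R i})"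
  define J where "J = (SIGMA i:{..<D}. {A i<..R i})"
  have "int (card I) - int (card J) = (\<Sum>i<D. R i + 1) - (\<Sum>i<D. R i - A i)"
    using RA by (simp add: I_def J_def card_SigmaI)
  also have "\<dots> = (\<Sum>i<D. A i + 1)" by (simp add: sum.distrib sum_subtractf)
  also have "\<dots> > 0"
  proof -
    have "- w K i \<le> \<omega> 0 * (A i + 1)" for i
      using A[of "A i + 1" i] by simp
    then have "- (\<Sum>i<D. w K i) \<le> \<omega> 0 * (\<Sum>i<D. A i + 1)"
      unfolding sum_distrib_left sum_negf[symmetric] by (rule sum_mono)
    then have "0 < \<omega> 0 * (\<Sum>i<D. A i + 1)" using D unfolding K_def by linarith
    then show ?thesis using omega0 by (simp add: zero_less_mult_iff)
  qed
  finally have "card J < card I" by simp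
  from underdetermined_system[OF _ _ this, of "\<lambda>(i, k) (j, a). fls_nth (c i j) (a - k)"]
  obtain u where u: "\<exists>s\<in>I. u s \<noteq> 0"
    "\<And>j a. (j, a) \<in> J \<Longrightarrow> (\<Sum>(i, k)\<in>I. u (i, k) * fls_nth (c i j) (a - k)) = 0"
    by (force simp: I_def J_def case_prod_unfold)
  define p where "p = (\<Sum>(i, k)\<in>I. monom (monom (u (i, k)) (nat k)) i)"
  have finI: "finite I" by (simp add: I_def)
  have "p \<noteq> 0"
  proof -
    obtain i k where ik: "(i, k) \<in> I" "u (i, k) \<noteq> 0" using u(1) by auto
    have "coeff (coeff p i) (nat k) = (\<Sum>s\<in>I. if s = (i, k) then u (i, k) else 0)"
      unfolding p_def coeff_sum
      using ik by (intro sum.cong) (auto simp: I_def coeff_monom split: if_splits)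
    then show ?thesis using ik finI by auto
  qed
  moreover have "emb p \<in> B K (-1)"
    unfolding B_def
  proof (clarify)
    fix j
    have "coords (E K) (emb p) j = (\<Sum>(i, k)\<in>I. fls_const (u (i, k)) * fls_X_intpow k * c i j)"
      unfolding p_def emb_sum coords_sum[OF M]
      by (intro sum.cong) (auto simp: I_def emb_monom coords_smult[OF M] c_def)
    then have nth: "fls_nth (coords (E K) (emb p) j) a =
        (\<Sum>(i, k)\<in>I. u (i, k) * fls_nth (c i j) (a - k))" for a
      by (simp only: fls_nth_sum case_prod_unfold fls_nth_monomial_mult)
    show "bnd (coords (E K) (emb p) j) (- 1 - w K j)"
      unfolding bnd_def
    proof (intro allI impI)
      fix a assume "fls_nth (coords (E K) (emb p) j) a \<noteq> 0"
      then have nz: "(\<Sum>(i, k)\<in>I. u (i, k) * fls_nth (c i j) (a - k)) \<noteq> 0" by (simp add: nth)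
      then obtain i k where ik: "(i, k) \<in> I" "fls_nth (c i j) (a - k) \<noteq> 0"
        by (metis (no_types, lifting) case_prod_unfold mult_zero_right prod.collapse sum.neutral)
      then have "i < D" "k \<le> R i" and ij: "j \<le> i" using c0[of i j] by (auto simp: I_def not_less[symmetric])
      \<comment> \<open>Passing from y^i to a coordinate j < i adds at most U to the exponent of x,
        while R grows by at least U.\<close>
      have "a \<le> R j"
      proof (cases "j = i")
        case True
        then show ?thesis using ik(2) \<open>k \<le> R i\<close> c1[of i] by (auto split: if_splits)
      next
        case False
        have "a - k \<le> U" using cU[OF \<open>i < D\<close> _ ik(2)] ij \<open>i < D\<close> by simp
        moreover have "(int j + 1) * U \<le> int i * U" using False ij U0 by (intro mult_right_mono) auto
        ultimately show ?thesis using \<open>k \<le> R i\<close> by (simp add: R_def algebra_simps)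
      qed
      moreover have "(j, a) \<notin> J" using u(2)[of j a] nz by auto
      ultimately show "\<omega> 0 * a \<le> - 1 - w K j" using A[of a j] ij \<open>i < D\<close> by (auto simp: J_def)
    qed
  qed
  ultimately show ?thesis by (auto simp: K_def)
qed

end

section \<open>Comparison with the function field\<close>

lemma of_bipoly_add: "of_bipoly (p + q) = of_bipoly p + of_bipoly q"
  by (simp add: of_bipoly_def)

lemma of_bipoly_mult: "of_bipoly (p * q) = of_bipoly p * of_bipoly q"
  by (simp add: of_bipoly_def)

lemma of_bipoly_0 [simp]: "of_bipoly 0 = 0"
  by (simp add: of_bipoly_def Zero_fract_def)

lemma of_bipoly_1 [simp]: "of_bipoly 1 = 1"
  by (simp add: of_bipoly_def One_fract_def)

lemma of_bipoly_eq_iff [simp]: "of_bipoly p = of_bipoly q \<longleftrightarrow> p = q"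
  by (simp add: of_bipoly_def eq_fract)

lemma of_bipoly_eq_0_iff [simp]: "of_bipoly p = 0 \<longleftrightarrow> p = 0"
  using of_bipoly_eq_iff[of p 0] by simp

lemma of_bipoly_diff: "of_bipoly (p - q) = of_bipoly p - of_bipoly q"
  using of_bipoly_add[of "p - q" q] by (simp add: eq_diff_eq)

lemma of_bipoly_power: "of_bipoly (p ^ k) = of_bipoly p ^ k"
  by (induction k) (auto simp: of_bipoly_mult)

lemma X_nonzero [simp]: "X \<noteq> 0"
  by (simp add: X_def)

lemma X_power: "X ^ k = of_bipoly [:[:0, 1:] ^ k:]"
  by (simp add: X_def of_bipoly_power[symmetric] poly_const_pow)

lemma emb_X_power: "emb [:[:0, 1:] ^ k:] = [:fls_X_intpow (int k):]"
  using emb_monom[of 1 k 0] by (simp add: monom_altdef)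

lemma cst_mult: "cst (a * b) = cst a * cst b"
  by (simp add: cst_def flip: of_bipoly_mult)

lemma cst_1: "cst 1 = 1"
  by (simp add: cst_def flip: one_pCons)

lemma cst_power: "cst (a ^ k) = cst a ^ k"
  by (induction k) (simp_all add: cst_1 cst_mult)

lemma cst_eq_0_iff [simp]: "cst c = 0 \<longleftrightarrow> c = 0"
  by (simp add: cst_def)

lemma Cxy_1: "1 \<in> Cxy"
  unfolding Cxy_def by (metis of_bipoly_1 rangeI)

lemma Cxy_mult: "u \<in> Cxy \<Longrightarrow> v \<in> Cxy \<Longrightarrow> u * v \<in> Cxy"
  by (auto simp: Cxy_def of_bipoly_mult[symmetric])

lemma Cxy_diff: "u \<in> Cxy \<Longrightarrow> v \<in> Cxy \<Longrightarrow> u - v \<in> Cxy"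
  by (auto simp: Cxy_def of_bipoly_diff[symmetric])

lemma Cxy_power: "u \<in> Cxy \<Longrightarrow> u ^ k \<in> Cxy"
  by (induction k) (auto intro: Cxy_mult Cxy_1)

lemma Cxy_prod: "(\<And>s. s \<in> A \<Longrightarrow> f s \<in> Cxy) \<Longrightarrow> prod f A \<in> Cxy"
  by (induction A rule: infinite_finite_induct) (auto intro: Cxy_mult Cxy_1)

lemma Cxy_cst: "cst c \<in> Cxy"
  by (simp add: Cxy_def cst_def)

lemma Cxy_X: "X \<in> Cxy" and Cxy_Y: "Y \<in> Cxy"
  by (simp_all add: Cxy_def X_def Y_def)

lemma Cxy_subset_Cxxinvy: "Cxy \<subseteq> Cxxinvy"
proof
  fix f assume "f \<in> Cxy"
  then have "f = f / X ^ 0 \<and> f \<in> Cxy" by simp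
  then show "f \<in> Cxxinvy" unfolding Cxxinvy_def by blast
qed

text \<open>\<open>rep u q\<close>: the element \<open>u\<close> of \<open>\<complex>[x,x\<^sup>-\<^sup>1,y]\<close> is \<open>q\<close>, read as a polynomial in \<open>y\<close> over \<open>\<complex>((x))\<close>.\<close>

definition rep :: "ratfun \<Rightarrow> complex fls poly \<Rightarrow> bool" where
  "rep u q \<longleftrightarrow> (\<exists>p N. u * X ^ N = of_bipoly p \<and> smult (fls_X_intpow (int N)) q = emb p)"

lemma repE:
  assumes "rep u q"
  obtains p N where "u * X ^ N = of_bipoly p" "smult (fls_X_intpow (int N)) q = emb p"
  using assms unfolding rep_def by blast

lemma rep_of_bipoly: "rep (of_bipoly p) (emb p)"
  unfolding rep_def by (intro exI[of _ p] exI[of _ 0]) simp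

lemma rep_scale:
  assumes "u * X ^ N = of_bipoly p" "smult (fls_X_intpow (int N)) q = emb p"
  shows "u * X ^ (N + M) = of_bipoly (p * [:[:0, 1:] ^ M:])"
    "smult (fls_X_intpow (int (N + M))) q = emb (p * [:[:0, 1:] ^ M:])"
proof -
  have "u * X ^ (N + M) = u * X ^ N * X ^ M" by (simp add: power_add)
  also have "\<dots> = of_bipoly p * X ^ M" by (simp only: assms(1))
  finally show "u * X ^ (N + M) = of_bipoly (p * [:[:0, 1:] ^ M:])"
    by (simp only: X_power of_bipoly_mult)
  have "emb (p * [:[:0, 1:] ^ M:]) = smult (fls_X_intpow (int N)) q * [:fls_X_intpow (int M):]"
    by (simp only: emb_mult emb_X_power assms(2))
  also have "\<dots> = smult (fls_X_intpow (int M) * fls_X_intpow (int N)) q" by simp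
  also have "\<dots> = smult (fls_X_intpow (int (N + M))) q"
    unfolding fls_X_intpow_times_fls_X_intpow by (simp add: add.commute)
  finally show "smult (fls_X_intpow (int (N + M))) q = emb (p * [:[:0, 1:] ^ M:])" ..
qed

lemma rep_common:
  assumes "rep u q" "rep v r"
  obtains p p' N where "u * X ^ N = of_bipoly p" "smult (fls_X_intpow (int N)) q = emb p"
    "v * X ^ N = of_bipoly p'" "smult (fls_X_intpow (int N)) r = emb p'"
proof -
  from assms obtain p N p' M where *: "u * X ^ N = of_bipoly p" "smult (fls_X_intpow (int N)) q = emb p"
    "v * X ^ M = of_bipoly p'" "smult (fls_X_intpow (int M)) r = emb p'"
    by (auto elim!: repE)
  show thesis
    using rep_scale[OF *(1,2), of M] rep_scale[OF *(3,4), of N]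
    by (intro that[of "N + M"]) (simp_all add: add.commute)
qed

lemma rep_add: assumes "rep u q" "rep v r" shows "rep (u + v) (q + r)"
proof -
  from rep_common[OF assms] obtain p p' N where
    "u * X ^ N = of_bipoly p" "smult (fls_X_intpow (int N)) q = emb p"
    "v * X ^ N = of_bipoly p'" "smult (fls_X_intpow (int N)) r = emb p'" .
  then show ?thesis unfolding rep_def
    by (intro exI[of _ "p + p'"] exI[of _ N])
       (simp add: distrib_right of_bipoly_add emb_add smult_add_right)
qed

lemma rep_mult: assumes "rep u q" "rep v r" shows "rep (u * v) (q * r)"
proof -
  from rep_common[OF assms] obtain p p' N where *:
    "u * X ^ N = of_bipoly p" "smult (fls_X_intpow (int N)) q = emb p"
    "v * X ^ N = of_bipoly p'" "smult (fls_X_intpow (int N)) r = emb p'" .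
  have "u * v * X ^ (N + N) = (u * X ^ N) * (v * X ^ N)" by (simp add: power_add)
  moreover have "smult (fls_X_intpow (int (N + N))) (q * r) =
      smult (fls_X_intpow (int N)) q * smult (fls_X_intpow (int N)) r"
    by (simp only: of_nat_add fls_X_intpow_times_fls_X_intpow[symmetric]
        mult_smult_left mult_smult_right smult_smult)
  ultimately show ?thesis unfolding rep_def * by (metis of_bipoly_mult emb_mult)
qed

lemma rep_unique: assumes "rep u q" "rep u r" shows "q = r"
proof -
  from rep_common[OF assms] obtain p p' N where
    "u * X ^ N = of_bipoly p" "smult (fls_X_intpow (int N)) q = emb p"
    "u * X ^ N = of_bipoly p'" "smult (fls_X_intpow (int N)) r = emb p'" .
  then have "smult (fls_X_intpow (int N)) q = smult (fls_X_intpow (int N)) r" by simp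
  then show ?thesis
    unfolding poly_eq_iff coeff_smult by (metis mult_left_cancel fls_X_intpow_nonzero)
qed

lemma rep_inj: assumes "rep u q" "rep v q" shows "u = v"
proof -
  from rep_common[OF assms] obtain p p' N where
    "u * X ^ N = of_bipoly p" "smult (fls_X_intpow (int N)) q = emb p"
    "v * X ^ N = of_bipoly p'" "smult (fls_X_intpow (int N)) q = emb p'" .
  then have "u * X ^ N = v * X ^ N" using emb_inj by metis
  then show ?thesis by simp
qed

lemma rep_0: "rep 0 0"
  using rep_of_bipoly[of 0] by (simp add: emb_0)

lemma rep_1: "rep 1 1"
  using rep_of_bipoly[of 1] emb_X_power[of 0] by (simp flip: one_pCons)

lemma rep_cst: "rep (cst c) [:fls_const c:]"
  using rep_of_bipoly[of "[:[:c:]:]"] emb_monom[of c 0 0] by (simp add: cst_def monom_0)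

lemma rep_Y: "rep Y [:0, 1:]"
  using rep_of_bipoly[of "[:0, 1:]"] emb_monom[of 1 0 1] by (simp add: Y_def monom_altdef one_pCons)

lemma rep_X_powi: "rep (X powi a) [:fls_X_intpow a:]"
proof (cases "a \<ge> 0")
  case True
  then show ?thesis
    using rep_of_bipoly[of "[:[:0, 1:] ^ nat a:]"]
    by (simp add: emb_X_power X_power power_int_def)
next
  case False
  have "X powi a * X ^ nat (- a) = of_bipoly 1" using False by (simp add: power_int_def field_simps)
  moreover have "smult (fls_X_intpow (int (nat (- a)))) [:fls_X_intpow a:] = emb 1"
    using False emb_X_power[of 0] fls_X_intpow_times_fls_X_intpow[of "- a" a, where ?'a = complex]
    by (simp add: one_pCons)
  ultimately show ?thesis unfolding rep_def by blast
qed

lemma rep_diff: assumes "rep u q" "rep v r" shows "rep (u - v) (q - r)"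
proof -
  have "cst (-1) = -1"
    using of_bipoly_diff[of 0 1] by (simp add: cst_def one_pCons flip: of_bipoly_1)
  then have "rep (- v) (- r)" using rep_mult[OF rep_cst[of "-1"] assms(2)] by simp
  from rep_add[OF assms(1) this] show ?thesis by simp
qed

lemma rep_power: "rep u q \<Longrightarrow> rep (u ^ k) (q ^ k)"
  by (induction k) (auto intro: rep_mult rep_1)

lemma rep_sum: "(\<And>s. s \<in> A \<Longrightarrow> rep (f s) (h s)) \<Longrightarrow> rep (sum f A) (sum h A)"
  by (induction A rule: infinite_finite_induct) (auto intro: rep_add rep_0)

lemma rep_prod: "(\<And>s. s \<in> A \<Longrightarrow> rep (f s) (h s)) \<Longrightarrow> rep (prod f A) (prod h A)"
  by (induction A rule: infinite_finite_induct) (auto intro: rep_mult rep_1)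

lemma rep_exists: assumes "u \<in> Cxxinvy" shows "\<exists>q. rep u q"
proof -
  obtain p k where "u = of_bipoly p / X ^ k" using assms by (auto simp: Cxxinvy_def Cxy_def)
  then have "u = of_bipoly p * X powi (- int k)" by (simp add: power_int_minus field_simps)
  then show ?thesis using rep_mult[OF rep_of_bipoly rep_X_powi] by blast
qed

lemma Cxy_repE:
  assumes "f \<in> Cxy"
  obtains p where "f = of_bipoly p" "rep f (emb p)" "regular (emb p)"
  using assms rep_of_bipoly regular_emb by (auto simp: Cxy_def)

lemma fls_bounded_above_expand:
  fixes c :: "'a::comm_ring_1 fls"
  assumes "\<And>a. fls_nth c a \<noteq> 0 \<Longrightarrow> a \<le> h"
  shows "c = (\<Sum>a\<in>{fls_subdegree c..h}. fls_const (fls_nth c a) * fls_X_intpow a)"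
proof (rule fls_eqI)
  fix i
  have "fls_nth (\<Sum>a\<in>{fls_subdegree c..h}. fls_const (fls_nth c a) * fls_X_intpow a) i =
      (\<Sum>a\<in>{fls_subdegree c..h}. if a = i then fls_nth c i else 0)"
    unfolding fls_nth_sum by (intro sum.cong) auto
  also have "\<dots> = fls_nth c i"
    using assms[of i] fls_subdegree_leI[of c i] by auto
  finally show "fls_nth c i =
    fls_nth (\<Sum>a\<in>{fls_subdegree c..h}. fls_const (fls_nth c a) * fls_X_intpow a) i" ..
qed

lemma lessThan_split_0: "1 \<le> j \<Longrightarrow> {..<j} = insert (0::nat) {1..<j}"
  by auto

locale key_form_data =
  fixes \<delta> :: "ratfun \<Rightarrow> int" and n :: nat and g :: "nat \<Rightarrow> ratfun"
    and \<beta> :: "nat \<Rightarrow> nat \<Rightarrow> int" and \<theta> :: "nat \<Rightarrow> complex" and \<omega> :: "nat \<Rightarrow> int" and \<alpha> :: "nat \<Rightarrow> nat"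
  defines "\<omega> \<equiv> \<lambda>j. \<delta> (g j)" and "\<alpha> \<equiv> key_alpha \<omega>"
  assumes valuation: "discrete_valuation (\<lambda>f. - \<delta> f)"
    and delta_X: "\<delta> X > 0"
    and g_Cxxinvy: "\<And>j. j \<le> Suc n \<Longrightarrow> g j \<in> Cxxinvy"
    and g_0: "g 0 = X" and g_1: "g (Suc 0) = Y"
    and P1: "\<And>j. 1 \<le> j \<Longrightarrow> j \<le> n \<Longrightarrow> \<omega> (Suc j) < int (\<alpha> j) * \<omega> j"
      "\<And>j. 1 \<le> j \<Longrightarrow> j \<le> n \<Longrightarrow> int (\<alpha> j) * \<omega> j = (\<Sum>i<j. \<beta> j i * \<omega> i)"
      "\<And>i j. 1 \<le> i \<Longrightarrow> i < j \<Longrightarrow> j \<le> n \<Longrightarrow> 0 \<le> \<beta> j i \<and> \<beta> j i < int (\<alpha> i)"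
    and P2: "\<And>j. 1 \<le> j \<Longrightarrow> j \<le> n \<Longrightarrow> \<theta> j \<noteq> 0"
      "\<And>j. 1 \<le> j \<Longrightarrow> j \<le> n \<Longrightarrow>
        g (Suc j) = g j ^ \<alpha> j - cst (\<theta> j) * (\<Prod>i<j. g i powi \<beta> j i)"
    and P3: "\<And>h. h \<in> Cxxinvy \<Longrightarrow> h \<noteq> 0 \<Longrightarrow>
      \<exists>G\<in>laurent_ring (Suc n). subst_laurent (Suc n) g G = h \<and> weighted_degree (Suc n) \<omega> G = \<delta> h"
begin

text \<open>The \<open>LEAST\<close> is attained since \<open>\<omega> 0\<close> is a candidate:
  \<omega>_0 \<omega>_j is a multiple of \<omega>_0.\<close>

lemma alpha_pos:
  assumes "1 \<le> j"
  shows "\<alpha> j > 0"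
proof -
  have "nat (\<omega> 0) > 0" using delta_X g_0 by (simp add: \<omega>_def)
  moreover have "int (nat (\<omega> 0)) * \<omega> j = (\<Sum>i<j. (if i = 0 then \<omega> j else 0) * \<omega> i)"
  proof -
    have "(\<Sum>i<j. (if i = 0 then \<omega> j else 0) * \<omega> i) = (\<Sum>i<j. if i = 0 then \<omega> j * \<omega> 0 else 0)"
      by (rule sum.cong) auto
    then show ?thesis using assms \<open>nat (\<omega> 0) > 0\<close> by (simp add: mult.commute)
  qed
  ultimately have "nat (\<omega> 0) > 0 \<and> (\<exists>c::nat \<Rightarrow> int. int (nat (\<omega> 0)) * \<omega> j = (\<Sum>i<j. c i * \<omega> i))"
    by (intro conjI exI[of _ "\<lambda>i. if i = 0 then \<omega> j else 0"])
  from LeastI[of "\<lambda>a. a > 0 \<and> (\<exists>c::nat \<Rightarrow> int. int a * \<omega> j = (\<Sum>i<j. c i * \<omega> i))", OF this]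
  show ?thesis by (simp add: \<alpha>_def key_alpha_def)
qed

definition gp :: "nat \<Rightarrow> complex fls poly" where "gp j = (THE q. rep (g j) q)"

lemma rep_gp: "j \<le> Suc n \<Longrightarrow> rep (g j) (gp j)"
  unfolding gp_def using rep_exists[OF g_Cxxinvy] by (metis rep_unique theI)

lemma g_Suc:
  assumes j: "1 \<le> j" "j \<le> n"
  shows "g (Suc j) = g j ^ \<alpha> j - cst (\<theta> j) * (X powi \<beta> j 0 * (\<Prod>i=1..<j. g i ^ nat (\<beta> j i)))"
proof -
  have "(\<Prod>i=1..<j. g i powi \<beta> j i) = (\<Prod>i=1..<j. g i ^ nat (\<beta> j i))"
    using P1(3)[of _ j] j by (intro prod.cong) (auto simp: power_int_def)
  then show ?thesis using P2(2)[OF j] lessThan_split_0[OF j(1)] by (simp add: g_0)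
qed

sublocale key_seq n \<alpha> "\<lambda>j. \<beta> j 0" "\<lambda>j i. nat (\<beta> j i)" \<theta> \<omega> gp
proof
  show "\<omega> 0 > 0" using delta_X by (simp add: \<omega>_def g_0)
  show "\<alpha> j > 0" if "1 \<le> j" for j by (rule alpha_pos) fact
  show "nat (\<beta> j i) < \<alpha> i" if "1 \<le> i" "i < j" "j \<le> n" for i j
    using P1(3)[OF that] by auto
  show "int (\<alpha> j) * \<omega> j = \<omega> 0 * \<beta> j 0 + (\<Sum>i=1..<j. \<omega> i * int (nat (\<beta> j i)))"
    if "1 \<le> j" "j \<le> n" for j
  proof -
    have "(\<Sum>i=1..<j. \<omega> i * int (nat (\<beta> j i))) = (\<Sum>i=1..<j. \<beta> j i * \<omega> i)"
      using P1(3)[of _ j] that by (intro sum.cong) auto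
    then show ?thesis using P1(2)[OF that] lessThan_split_0[OF that(1)] by simp
  qed
  show "\<omega> (Suc j) < int (\<alpha> j) * \<omega> j" "\<theta> j \<noteq> 0" if "1 \<le> j" "j \<le> n" for j
    using P1(1) P2(1) that by auto
  show "gp (Suc 0) = [:0, 1:]"
    using rep_unique[OF rep_gp[of "Suc 0"]] rep_Y g_1 by simp
  show "gp (Suc j) = gp j ^ \<alpha> j -
      smult (fls_const (\<theta> j) * fls_X_intpow (\<beta> j 0)) (\<Prod>i=1..<j. gp i ^ nat (\<beta> j i))"
    if "1 \<le> j" "j \<le> n" for j
  proof -
    let ?P = "\<Prod>i=1..<j. gp i ^ nat (\<beta> j i)"
    have "rep (g (Suc j)) (gp j ^ \<alpha> j - [:fls_const (\<theta> j):] * ([:fls_X_intpow (\<beta> j 0):] * ?P))"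
      unfolding g_Suc[OF that] using that
      by (intro rep_diff rep_mult rep_power rep_prod rep_cst rep_X_powi rep_gp) auto
    from rep_unique[OF rep_gp this] that show ?thesis by (simp add: mult.commute)
  qed
qed

lemma delta_g: "\<delta> (g j) = \<omega> j"
  by (simp add: \<omega>_def)

lemma delta_X_eq: "\<delta> X = \<omega> 0"
  by (simp add: \<omega>_def g_0)

subsection \<open>The semidegree\<close>

lemma delta_mult: "u \<noteq> 0 \<Longrightarrow> v \<noteq> 0 \<Longrightarrow> \<delta> (u * v) = \<delta> u + \<delta> v"
  using valuation by (force simp: discrete_valuation_def)

lemma delta_add: "u \<noteq> 0 \<Longrightarrow> v \<noteq> 0 \<Longrightarrow> u + v \<noteq> 0 \<Longrightarrow> \<delta> (u + v) \<le> max (\<delta> u) (\<delta> v)"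
  using valuation by (force simp: discrete_valuation_def)

lemma delta_1: "\<delta> 1 = 0"
  using delta_mult[of 1 1] by simp

lemma delta_power: "u \<noteq> 0 \<Longrightarrow> \<delta> (u ^ k) = int k * \<delta> u"
  by (induction k) (auto simp: delta_1 delta_mult algebra_simps)

lemma delta_inverse: "u \<noteq> 0 \<Longrightarrow> \<delta> (inverse u) = - \<delta> u"
  using delta_mult[of u "inverse u"] by (simp add: delta_1)

lemma delta_powi: "u \<noteq> 0 \<Longrightarrow> \<delta> (u powi a) = a * \<delta> u"
  by (simp add: power_int_def delta_power delta_inverse)

text \<open>A nonzero constant has roots of all orders, so its semidegree is divisible by all integers.\<close>

lemma delta_cst:
  assumes "c \<noteq> 0"
  shows "\<delta> (cst c) = 0"
proof (rule ccontr)
  assume nz: "\<delta> (cst c) \<noteq> 0"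
  define k where "k = nat \<bar>\<delta> (cst c)\<bar> + 1"
  have k: "k > 0" by (simp add: k_def)
  obtain z where z: "z ^ k = c" using nth_root_exists[OF k, of c] by blast
  with assms k have "z \<noteq> 0" by auto
  have "\<delta> (cst c) = int k * \<delta> (cst z)" using \<open>z \<noteq> 0\<close> by (simp add: cst_power delta_power flip: z)
  then have "int k dvd \<delta> (cst c)" by simp
  from dvd_imp_le_int[OF nz this] show False by (simp add: k_def)
qed

section \<open>The semidegree as the order of the filtration at level n+1\<close>

definition delta_le :: "int \<Rightarrow> ratfun \<Rightarrow> bool" where
  "delta_le v u \<longleftrightarrow> u = 0 \<or> \<delta> u \<le> v"

lemma delta_le_add: "delta_le v a \<Longrightarrow> delta_le v b \<Longrightarrow> delta_le v (a + b)"
  using delta_add[of a b] unfolding delta_le_def by fastforce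

lemma delta_le_sum: "(\<And>s. s \<in> A \<Longrightarrow> delta_le v (f s)) \<Longrightarrow> delta_le v (sum f A)"
  by (induction A rule: infinite_finite_induct) (auto intro: delta_le_add simp: delta_le_def[of _ 0])

text \<open>The optimal G of (P3) need not be reduced, but by multiplicativity each of its monomials
  lies in the step of the filtration given by its weight.\<close>

lemma in_B:
  assumes h: "h \<in> Cxxinvy" "h \<noteq> 0" "rep h q"
  shows "q \<in> B (Suc n) (\<delta> h)"
proof -
  obtain G where G: "subst_laurent (Suc n) g G = h" "weighted_degree (Suc n) \<omega> G = \<delta> h"
    using P3[OF h(1,2)] by blast
  let ?K = "Poly_Mapping.keys G"
  define H where "H e = [:fls_const (Poly_Mapping.lookup G e):] * [:fls_X_intpow (fst e):] *
    (\<Prod>j=1..Suc n. gp j ^ Poly_Mapping.lookup (snd e) j)" for e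
  define wt where
    "wt e = \<omega> 0 * fst e + (\<Sum>j=1..Suc n. \<omega> j * int (Poly_Mapping.lookup (snd e) j))" for e :: "int \<times> (nat \<Rightarrow>\<^sub>0 nat)"
  have "rep h (\<Sum>e\<in>?K. H e)"
    unfolding G(1)[symmetric] subst_laurent_def H_def
    by (intro rep_sum rep_mult rep_prod rep_power rep_cst rep_X_powi rep_gp) auto
  then have "q = (\<Sum>e\<in>?K. H e)" using rep_unique h(3) by blast
  also have "\<dots> \<in> B (Suc n) (\<delta> h)"
  proof (rule B_sum)
    fix e assume e: "e \<in> ?K"
    have "gp j \<in> B (Suc n) (\<omega> j)" if "j \<in> {1..Suc n}" for j
      using gp_in_B[of j] B_subset[of j "Suc n"] that by auto
    then have "(\<Prod>j=1..Suc n. gp j ^ Poly_Mapping.lookup (snd e) j)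
        \<in> B (Suc n) (\<Sum>j=1..Suc n. int (Poly_Mapping.lookup (snd e) j) * \<omega> j)"
      by (intro B_prod B_power) auto
    from B_smult[OF _ bnd_const_X this, of "Poly_Mapping.lookup G e" "fst e"]
    have "H e \<in> B (Suc n) (wt e)" by (simp add: H_def wt_def mult.commute add.commute)
    moreover have "wt e \<le> Max (wt ` ?K)" using e by (intro Max_ge) auto
    then have "wt e \<le> \<delta> h" using G(2) by (simp add: weighted_degree_def wt_def)
    ultimately show "H e \<in> B (Suc n) (\<delta> h)" using B_mono by blast
  qed simp
  finally show ?thesis .
qed

lemma g_nonzero: "1 \<le> j \<Longrightarrow> j \<le> Suc n \<Longrightarrow> g j \<noteq> 0"
  using rep_gp[of j] rep_unique[OF rep_0, of "gp j"] gp_monic[of j] by (auto simp: monic_of_degree_def)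

text \<open>Level 0 is restricted to i = 0 because the weight of y there is artificial. This
  suffices, as level 1 uses only the remainder 0 modulo \<open>d (Suc 0)\<close>.\<close>

lemma rep_E_exists:
  "k \<le> Suc n \<Longrightarrow> k = 0 \<longrightarrow> i = 0 \<Longrightarrow> \<exists>u. rep u (E k i) \<and> u \<noteq> 0 \<and> \<delta> u = w k i"
proof (induction k arbitrary: i)
  case 0
  then show ?case using rep_1 delta_1 by (intro exI[of _ 1]) auto
next
  case (Suc k)
  let ?D = "d (Suc k)"
  have i0: "k = 0 \<longrightarrow> i mod ?D = 0" by auto
  obtain u where u: "rep u (E k (i mod ?D))" "u \<noteq> 0" "\<delta> u = w k (i mod ?D)"
    using Suc.IH[OF _ i0] Suc.prems(1) by auto
  have g: "g (Suc k) \<noteq> 0" using g_nonzero Suc.prems by simp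
  show ?case
    using u g Suc.prems rep_mult[OF u(1) rep_power[OF rep_gp[of "Suc k"], of "i div ?D"]]
    by (intro exI[of _ "u * g (Suc k) ^ (i div ?D)"])
       (auto simp: delta_mult delta_power delta_g mult.commute)
qed

text \<open>The reduced expansion is a finite sum of monomials x^a times a basis element, and the
  semidegree of each of them equals its weight.\<close>

lemma delta_le_B:
  assumes q: "q \<in> B (Suc n) v" and u: "rep u q"
  shows "delta_le v u"
proof -
  let ?c = "coords (E (Suc n)) q"
  obtain U where U: "\<And>i. rep (U i) (E (Suc n) i)" "\<And>i. U i \<noteq> 0" "\<And>i. \<delta> (U i) = w (Suc n) i"
  proof -
    have "\<forall>i. \<exists>u. rep u (E (Suc n) i) \<and> u \<noteq> 0 \<and> \<delta> u = w (Suc n) i"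
      using rep_E_exists[of "Suc n"] by blast
    from choice[OF this] show thesis using that by blast
  qed
  \<comment> \<open>An upper bound for the exponents of x in coordinate i, valid because
    \<open>\<omega> 0\<close> is at least 1; it turns the Laurent series into finite sums.\<close>
  define h where "h i = \<bar>v - w (Suc n) i\<bar>" for i
  have bnd: "bnd (?c i) (v - w (Suc n) i)" for i using B_expand(2)[OF _ q] by simp
  have h: "a \<le> h i" if "fls_nth (?c i) a \<noteq> 0" for i a
  proof -
    have "\<omega> 0 * a \<le> v - w (Suc n) i" using bnd that by (simp add: bnd_def)
    moreover have "a \<le> \<omega> 0 * a" if "a > 0" using omega0 that by simp
    ultimately show ?thesis unfolding h_def by linarith
  qed
  let ?S = "\<lambda>i. {fls_subdegree (?c i)..h i}"
  define T where "T i a = cst (fls_nth (?c i) a) * X powi a" for i a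
  have "q = (\<Sum>i\<le>degree q. [:?c i:] * E (Suc n) i)" using B_expand(1)[OF _ q] by simp
  also have "\<dots> = (\<Sum>i\<le>degree q. (\<Sum>a\<in>?S i. [:fls_const (fls_nth (?c i) a):] * [:fls_X_intpow a:]) * E (Suc n) i)"
  proof (intro sum.cong refl arg_cong2[where f = "(*)"])
    fix i
    have *: "[:sum f A:] = (\<Sum>a\<in>A. [:f a:])" for f :: "int \<Rightarrow> complex fls" and A
      by (rule poly_eqI) (auto simp: coeff_sum coeff_pCons split: nat.splits)
    have "[:?c i:] = [:\<Sum>a\<in>?S i. fls_const (fls_nth (?c i) a) * fls_X_intpow a:]"
      by (rule arg_cong[OF fls_bounded_above_expand[of "?c i" "h i", OF h]])
    then show "[:?c i:] = (\<Sum>a\<in>?S i. [:fls_const (fls_nth (?c i) a):] * [:fls_X_intpow a:])"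
      unfolding * by (simp add: mult.commute)
  qed
  finally have "rep (\<Sum>i\<le>degree q. (\<Sum>a\<in>?S i. T i a) * U i) q"
    unfolding T_def
    by (elim ssubst[where P = "rep _"]) (intro rep_sum rep_mult rep_cst rep_X_powi U)
  then have "u = (\<Sum>i\<le>degree q. \<Sum>a\<in>?S i. T i a * U i)"
    using rep_inj[OF u] by (simp add: sum_distrib_right)
  also have "delta_le v \<dots>"
  proof (intro delta_le_sum)
    fix i a
    show "delta_le v (T i a * U i)"
    proof (cases "fls_nth (?c i) a = 0")
      case True
      then show ?thesis by (simp add: T_def delta_le_def)
    next
      case False
      then have "\<omega> 0 * a \<le> v - w (Suc n) i" using bnd by (simp add: bnd_def)
      then show ?thesis using False U(2,3)
        by (simp add: delta_le_def T_def delta_mult delta_cst delta_powi delta_X_eq mult.commute)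
    qed
  qed
  finally show ?thesis .
qed

section \<open>Semidegrees of polynomials and the criteria\<close>

lemma degree_0_eq_cst:
  assumes "degree p = 0" "bnd (lead_coeff (emb p)) v" "v \<le> 0"
  shows "of_bipoly p \<in> range cst"
proof -
  obtain c where c: "p = [:c:]" using assms(1) by (auto elim: degree_eq_zeroE)
  have "coeff c k = 0" if "k > 0" for k
  proof -
    have "fls_nth (lead_coeff (emb p)) (int k) = coeff c k"
      by (simp add: degree_emb coeff_emb c)
    moreover have "\<omega> 0 * int k > 0" using that omega0 by simp
    ultimately show ?thesis using assms(2,3) unfolding bnd_def by (metis leD order_trans)
  qed
  then have "degree c = 0" by (metis gr0I leading_coeff_0_iff degree_0)
  then obtain a where "c = [:a:]" by (auto elim: degree_eq_zeroE)
  then show ?thesis by (auto simp: c cst_def)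
qed

text \<open>The leading coefficient in y is the top coordinate. It is a nonzero element of C[x],
  hence contains some x^a with a >= 0, and so the weight of the top monomial is at least that of its
  basis element.\<close>

lemma Cxy_facts:
  assumes "f \<in> Cxy" "f \<noteq> 0"
  obtains p where "f = of_bipoly p" "rep f (emb p)" "emb p \<in> B (Suc n) (\<delta> f)"
    "bnd (lead_coeff (emb p)) (\<delta> f - w (Suc n) (degree p))" "w (Suc n) (degree p) \<le> \<delta> f"
proof -
  from assms(1) obtain p where p: "f = of_bipoly p" "rep f (emb p)" "regular (emb p)"
    by (rule Cxy_repE)
  have B: "emb p \<in> B (Suc n) (\<delta> f)" using in_B assms p Cxy_subset_Cxxinvy by blast
  have b: "bnd (lead_coeff (emb p)) (\<delta> f - w (Suc n) (degree p))"
    using bnd_lead_coeff[OF _ B] by (simp add: degree_emb)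
  have "p \<noteq> 0" using p assms(2) by auto
  then have "lead_coeff (emb p) \<noteq> 0" using emb_inj[of p 0] by (auto simp: emb_0)
  then obtain a where a: "fls_nth (lead_coeff (emb p)) a \<noteq> 0" by (metis fls_zero_eqI)
  then have "a \<ge> 0" using p(3) unfolding regular_def nonneg_powers_def by force
  then have "0 \<le> \<omega> 0 * a" using omega0 by simp
  with a b have "w (Suc n) (degree p) \<le> \<delta> f" unfolding bnd_def by fastforce
  with p(1,2) B b show thesis by (rule that)
qed

lemma delta_nonneg:
  assumes "\<omega> (Suc n) \<ge> 0" "f \<in> Cxy" "f \<noteq> 0"
  shows "\<delta> f \<ge> 0"
  using Cxy_facts[OF assms(2,3)] w_Suc_n_nonneg[OF assms(1)] by (metis order_trans)

lemma exists_negative: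
  assumes "\<omega> (Suc n) < 0"
  shows "\<exists>f\<in>Cxy - {0}. \<delta> f < 0"
proof -
  obtain p where p: "p \<noteq> 0" "emb p \<in> B (Suc n) (-1)" using negative_weight_polynomial[OF assms] by blast
  from delta_le_B[OF p(2) rep_of_bipoly] p(1) show ?thesis
    by (intro bexI[of _ "of_bipoly p"]) (auto simp: delta_le_def Cxy_def)
qed

lemma g_polynomial:
  assumes f: "f \<in> Cxy" "f \<notin> range cst" "\<delta> f \<le> 0" and om: "\<omega> (Suc n) = 0" and k: "k \<le> Suc n"
  shows "g k \<in> Cxy"
proof -
  have nz: "f \<noteq> 0" using f(2) by (metis cst_eq_0_iff rangeI)
  obtain p where p: "f = of_bipoly p" "rep f (emb p)" "emb p \<in> B (Suc n) (\<delta> f)"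
    "bnd (lead_coeff (emb p)) (\<delta> f - w (Suc n) (degree p))" "w (Suc n) (degree p) \<le> \<delta> f"
    using Cxy_facts[OF f(1) nz] by blast
  have "degree p > 0"
    using degree_0_eq_cst[of p "\<delta> f - w (Suc n) (degree p)"] p f(2,3) w_Suc_n_nonneg[of "degree p"] om
    by force
  \<comment> \<open>Otherwise the top monomial would have positive weight, exceeding the semidegree
    of f.\<close>
  moreover have "d (Suc n) dvd degree p"
    using w_Suc_n_pos[of "degree p"] om p(5) f(3) \<open>degree p > 0\<close> by fastforce
  ultimately obtain L where L: "degree p = L * d (Suc n)" "L > 0" by (auto elim!: dvdE simp: mult.commute)
  have bnd0: "bnd (lead_coeff (emb p)) 0"
    using p(4) f(3) w_Suc_n_nonneg[of "degree p"] om by (elim bnd_mono) simp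
  define c where "c = fls_nth (lead_coeff (emb p)) 0"
  have lc: "lead_coeff (emb p) = fls_const c"
  proof (rule fls_eqI)
    fix a
    have "fls_nth (lead_coeff (emb p)) a = 0" if "a < 0"
      using regular_emb[of p] that by (simp add: regular_def nonneg_powers_def)
    moreover have "fls_nth (lead_coeff (emb p)) a = 0" if "a > 0"
      using bnd0 mult_pos_pos[OF omega0 that] unfolding bnd_def by fastforce
    ultimately show "fls_nth (lead_coeff (emb p)) a = fls_nth (fls_const c) a"
      by (cases a "0::int" rule: linorder_cases) (auto simp: c_def)
  qed
  have "p \<noteq> 0" using p nz by auto
  then have c: "c \<noteq> 0" using lc emb_inj[of p 0] by (auto simp: emb_0)
  \<comment> \<open>The leading coefficient is a nonzero constant, so f can be normalised to be
    monic in y without leaving C[x,y].\<close>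
  define r where "r = smult [:inverse c:] p"
  have er: "emb r = smult (fls_const (inverse c)) (emb p)"
    using emb_mult[of "[:[:inverse c:]:]" p] emb_monom[of "inverse c" 0 0] by (simp add: r_def monom_0)
  have "monic_of_degree (emb r) (L * d (Suc n))"
    using lc c L by (simp add: er monic_of_degree_def degree_emb)
  moreover have "emb p \<in> B (Suc n) 0" using p(3) f(3) B_mono by blast
  from B_smult[OF _ bnd_const this, of "inverse c"]
  have "emb r \<in> B (Suc n) (int L * \<omega> (Suc n))" by (simp add: er om)
  ultimately have e: "\<beta> j 0 \<ge> 0" if "1 \<le> j" "j \<le> n" for j
    using e_nonneg[OF _ _ L(2) regular_emb that] by blast
  show ?thesis using k
  proof (induction k rule: less_induct)
    case (less k)
    consider "k = 0" | "k = Suc 0" | j where "k = Suc j" "1 \<le> j" "j \<le> n"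
      using less.prems by (cases k) force+
    then show ?case
    proof cases
      case 3
      have "X powi \<beta> j 0 = X ^ nat (\<beta> j 0)" using e 3 by (simp add: power_int_def)
      moreover have "(\<Prod>i=1..<j. g i ^ nat (\<beta> j i)) \<in> Cxy"
        using less 3 by (intro Cxy_prod Cxy_power) auto
      ultimately show ?thesis
        unfolding 3(1) g_Suc[OF 3(2,3)] using less 3
        by (auto intro!: Cxy_diff Cxy_mult Cxy_power Cxy_cst Cxy_X)
    qed (auto simp: g_0 g_1 Cxy_X Cxy_Y)
  qed
qed

lemma g_Suc_n_nonconst: "g (Suc n) \<notin> range cst"
proof
  assume "g (Suc n) \<in> range cst"
  then obtain c where "g (Suc n) = cst c" by blast
  then have "gp (Suc n) = [:fls_const c:]"
    using rep_unique[OF rep_gp[of "Suc n"], of "[:fls_const c:]"] rep_cst[of c] by simp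
  then show False using gp_monic[of "Suc n"] d_pos[of "Suc n"] by (auto simp: monic_of_degree_def)
qed

theorem nonneg_iff: "nonneg_on_Cxy \<delta> \<longleftrightarrow> \<delta> (g (Suc n)) \<ge> 0"
  using delta_nonneg exists_negative unfolding nonneg_on_Cxy_def delta_g
  by (metis DiffE insertI1 not_le)

lemma positive_if: "\<delta> (g (Suc n)) > 0 \<Longrightarrow> positive_on_Cxy \<delta>"
  unfolding positive_on_Cxy_def
proof
  fix f assume om: "\<delta> (g (Suc n)) > 0" and f: "f \<in> Cxy - range cst"
  then have nz: "f \<noteq> 0" by (metis DiffD2 cst_eq_0_iff rangeI)
  obtain p where p: "f = of_bipoly p"
    "bnd (lead_coeff (emb p)) (\<delta> f - w (Suc n) (degree p))" "w (Suc n) (degree p) \<le> \<delta> f"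
    using Cxy_facts[of f] f nz by blast
  show "\<delta> f > 0"
  proof (cases "degree p = 0")
    case True
    then show ?thesis using degree_0_eq_cst[OF True p(2)] p(1) f by force
  next
    case False
    then show ?thesis using w_Suc_n_pos[of "degree p"] om p(3) by (force simp: delta_g)
  qed
qed

text \<open>A polynomial g_{n+1} of semidegree 0 itself refutes positivity, being nonconstant. A
  polynomial of negative semidegree is nonconstant because constants have semidegree 0.\<close>

lemma positive_iff:
  "positive_on_Cxy \<delta> \<longleftrightarrow>
    \<delta> (g (Suc n)) > 0 \<or> (\<delta> (g (Suc n)) = 0 \<and> g (Suc n) \<notin> Cxy)"
proof (cases "\<delta> (g (Suc n))" "0::int" rule: linorder_cases)
  case less
  then obtain f where "f \<in> Cxy - {0}" "\<delta> f < 0" using exists_negative by (auto simp: delta_g)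
  moreover from this have "f \<notin> range cst" using delta_cst by force
  ultimately show ?thesis using less by (force simp: positive_on_Cxy_def)
next
  case equal
  have "positive_on_Cxy \<delta>" if "g (Suc n) \<notin> Cxy"
    unfolding positive_on_Cxy_def using g_polynomial[of _ "Suc n"] equal that
    by (force simp: delta_g not_le[symmetric])
  moreover have "\<not> positive_on_Cxy \<delta>" if "g (Suc n) \<in> Cxy"
    using g_Suc_n_nonconst equal that by (force simp: positive_on_Cxy_def)
  ultimately show ?thesis using equal by auto
next
  case greater
  then show ?thesis using positive_if by simp
qed

text \<open>If g_{n+1} is a polynomial, it is itself a nonconstant polynomial of semidegree 0, and
  \<open>g_polynomial\<close> applies to it.\<close>

lemma polynomial_iff:
  assumes "\<delta> (g (Suc n)) = 0"
  shows "(\<exists>k\<le>Suc n. g k \<notin> Cxy) \<longleftrightarrow> g (Suc n) \<notin> Cxy"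
  using g_polynomial[of "g (Suc n)"] g_Suc_n_nonconst assms by (auto simp: delta_g)

end

theorem theorem1p4:
  fixes \<delta> :: "ratfun \<Rightarrow> int" and n :: nat and g :: "nat \<Rightarrow> ratfun"
  assumes "divisorial_semidegree_on_Cxy \<delta>"
    and "\<delta> X > 0"
    and "key_forms \<delta> n g"
  shows "(nonneg_on_Cxy \<delta> \<longleftrightarrow> \<delta> (g (n + 1)) \<ge> 0) \<and>
    (positive_on_Cxy \<delta> \<longleftrightarrow>
       \<delta> (g (n + 1)) > 0 \<or> (\<delta> (g (n + 1)) = 0 \<and> (\<exists>k\<le>n + 1. g k \<notin> Cxy))) \<and>
    (positive_on_Cxy \<delta> \<longleftrightarrow>
       \<delta> (g (n + 1)) > 0 \<or> (\<delta> (g (n + 1)) = 0 \<and> g (n + 1) \<notin> Cxy)) \<and>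
    ((\<delta> (g (n + 1)) = 0 \<and> (\<exists>k\<le>n + 1. g k \<notin> Cxy)) \<longleftrightarrow>
     (\<delta> (g (n + 1)) = 0 \<and> g (n + 1) \<notin> Cxy))"
proof -
  let ?\<omega> = "\<lambda>j. \<delta> (g j)"
  let ?\<alpha> = "key_alpha ?\<omega>"
  note kf = assms(3)[unfolded key_forms_def Let_def]
  from kf have g: "\<forall>j\<le>n + 1. g j \<in> Cxxinvy" by (elim conjE)
  from kf have g0: "g 0 = X" by (elim conjE)
  from kf have g1: "g 1 = Y" by (elim conjE)
  from kf have P3: "\<forall>h\<in>Cxxinvy - {0}. \<exists>G\<in>laurent_ring (n + 1).
      subst_laurent (n + 1) g G = h \<and> weighted_degree (n + 1) ?\<omega> G = \<delta> h"
    by blast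
  from kf obtain \<beta> :: "nat \<Rightarrow> nat \<Rightarrow> int" and \<theta> where
    P1: "\<forall>j\<in>{1..n}. \<delta> (g (j + 1)) < int (?\<alpha> j) * \<delta> (g j) \<and>
      int (?\<alpha> j) * \<delta> (g j) = (\<Sum>i<j. \<beta> j i * \<delta> (g i)) \<and>
      (\<forall>i. 1 \<le> i \<and> i < j \<longrightarrow> 0 \<le> \<beta> j i \<and> \<beta> j i < int (?\<alpha> i))" and
    P2: "\<forall>j\<in>{1..n}. \<theta> j \<noteq> 0 \<and> g (j + 1) = g j ^ ?\<alpha> j - cst (\<theta> j) * (\<Prod>i<j. g i powi \<beta> j i)"
    by (elim conjE exE) (rule that)
  have "discrete_valuation (\<lambda>f. - \<delta> f)"
    using assms(1) by (simp add: divisorial_semidegree_on_Cxy_def divisorial_valuation_def)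
  then have "key_form_data \<delta> n g \<beta> \<theta>"
  proof unfold_locales
    fix j assume "1 \<le> j" "j \<le> n"
    then have j: "j \<in> {1..n}" by simp
    show "\<delta> (g (Suc j)) < int (?\<alpha> j) * \<delta> (g j)"
      "int (?\<alpha> j) * \<delta> (g j) = (\<Sum>i<j. \<beta> j i * \<delta> (g i))"
      unfolding Suc_eq_plus1 using bspec[OF P1 j] by blast+
    show "\<theta> j \<noteq> 0" "g (Suc j) = g j ^ ?\<alpha> j - cst (\<theta> j) * (\<Prod>i<j. g i powi \<beta> j i)"
      unfolding Suc_eq_plus1 using bspec[OF P2 j] by blast+
  next
    fix i j :: nat assume ij: "1 \<le> i" "i < j" "j \<le> n"
    then have "j \<in> {1..n}" by simp
    from bspec[OF P1 this] ij show "0 \<le> \<beta> j i \<and> \<beta> j i < int (?\<alpha> i)" by blast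
  qed (use assms(2) g g0 g1 P3 in auto)
  then interpret key_form_data \<delta> n g \<beta> \<theta> "\<lambda>j. \<delta> (g j)" "key_alpha (\<lambda>j. \<delta> (g j))" .
  show ?thesis using nonneg_iff positive_iff polynomial_iff by auto
qed

end
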